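(* Let $e\ge 3$ be an odd integer, $q=2^e$, and let $\mathcal{C}^3_\varepsilon:=\mathcal{C}(\mathcal{V}^3_\varepsilon)$ be the code over $\mathbb{F}_{q^2}$ generated by the point set $\mathcal{V}^3_\varepsilon\subset\mathrm{PG}(3,q^2)$ (defined in the context, with $r=3$). Then $\mathcal{C}^3_\varepsilon$ is a linear code of length $|\mathcal{V}^3_\varepsilon|$ and dimension $4$ with minimum distance $d=|\mathcal{V}^3_\varepsilon|-q^3-q^2-1$. Moreover, its $m$-th generalized Hamming weights $d_m$, $m\in\{1,2,3\}$, are $$d_1=|\mathcal{V}^3_\varepsilon|-q^3-q^2-1,\qquad d_2=|\mathcal{V}^3_\varepsilon|-q^2-1,\qquad d_3=|\mathcal{V}^3_\varepsilon|-1.$$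
   Context: Let $e\ge 3$ be odd, $q=2^e$, $r\ge 2$. Points of $\mathrm{PG}(r,q^2)$ (projective space of projective dimension $r$ over $\mathbb{F}_{q^2}$) have homogeneous coordinates $(X_0,\dots,X_r)$; $\Pi_\infty$ is the hyperplane $X_0=0$, and affine coordinates on the complement $\mathrm{AG}(r,q^2)$ are $x_i=X_i/X_0$. For an exponent involving $\sigma$, $\sigma$ stands for $2^{(e+1)/2}$, i.e. $x^{\sigma}=x^{2^{(e+1)/2}}$ and $x^{\sigma+2}=x^{2^{(e+1)/2}+2}$. Fix $\varepsilon\in\mathbb{F}_{q^2}\setminus\mathbb{F}_q$ such that $\varepsilon^2+\varepsilon+\delta=0$ for some $\delta\in\mathbb{F}_q\setminus\{1\}$ with absolute trace $\mathrm{Tr}_{q/2}(\delta)=\sum_{i=0}^{e-1}\delta^{2^i}=1$. Put $$\Gamma_{\varepsilon}(x)=[x+(x^q+x)\varepsilon]^{\sigma+2}+(x^q+x)^{\sigma}+(x^{2q}+x^2)\varepsilon+x^{q+1}+x^2.$$ $\mathcal{V}^r_\varepsilon$ is the projective hypersurface of $\mathrm{PG}(r,q^2)$ with affine equation $x_r^q+x_r=\Gamma_{\varepsilon}(x_1)+\dots+\Gamma_{\varepsilon}(x_{r-1})$, i.e. the zero locus of the homogenization (with respect to $X_0$) of the corresponding polynomial; it is identified with its set of $\mathbb{F}_{q^2}$-rational points. For a set $\Omega$ of $N$ points of $\mathrm{PG}(r,q^2)$, $\mathcal{C}(\Omega)$ is the linear code of length $N$ over $\mathbb{F}_{q^2}$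 spanned by the rows of an $(r+1)\times N$ matrix whose columns are coordinate vectors of the points of $\Omega$ (one representative per point); it is unique up to monomial equivalence. The support of a (sub)code is the union of the supports of its codewords, where $\mathrm{supp}(c)=\{i:c_i\neq 0\}$. The $m$-th generalized Hamming weight (called $m$-th higher minimum weight) of $\mathcal{C}$ is $d_m(\mathcal{C})=\min\{|\mathrm{supp}(\mathcal{D})| : \mathcal{D}\le\mathcal{C},\ \dim\mathcal{D}=m\}$. *)

theory Defs
  imports Complex_Main "HOL-Library.Poly_Mapping" "HOL-Library.Function_Algebras"
begin

text \<open>A vector of length \<open>n\<close> is a function on the naturals vanishing outside \<open>{..<n}\<close>.\<close>

definition scale_fun :: "'a::field \<Rightarrow> (nat \<Rightarrow> 'a) \<Rightarrow> nat \<Rightarrow> 'a" where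
  "scale_fun c f = (\<lambda>i. c * f i)"

global_interpretation fn: vector_space scale_fun
  by unfold_locales (auto simp: scale_fun_def algebra_simps fun_eq_iff)

definition coord_space :: "nat \<Rightarrow> (nat \<Rightarrow> 'a::field) set" where
  "coord_space n = {x. \<forall>i\<ge>n. x i = 0}"

text \<open>Points of \<open>PG(r, F)\<close> are the one-dimensional subspaces of \<open>F\<^sup>r\<^sup>+\<^sup>1\<close>,
  with coordinates \<open>X\<^sub>0, \<dots>, X\<^sub>r\<close>.\<close>

definition PG :: "nat \<Rightarrow> (nat \<Rightarrow> 'a::field) set set" where
  "PG r = {P. fn.subspace P \<and> P \<subseteq> coord_space (Suc r) \<and> fn.dim P = 1}"

type_synonym 'a mvpoly = "(nat \<Rightarrow>\<^sub>0 nat) \<Rightarrow>\<^sub>0 'a"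

definition Cst :: "'a::field \<Rightarrow> 'a mvpoly" where
  "Cst c = Poly_Mapping.single 0 c"

definition Var :: "nat \<Rightarrow> 'a::field mvpoly" where
  "Var i = Poly_Mapping.single (Poly_Mapping.single i 1) 1"

definition mon_degree :: "(nat \<Rightarrow>\<^sub>0 nat) \<Rightarrow> nat" where
  "mon_degree m = (\<Sum>i\<in>Poly_Mapping.keys m. Poly_Mapping.lookup m i)"

definition total_degree :: "'a::field mvpoly \<Rightarrow> nat" where
  "total_degree p = Max (insert 0 (mon_degree ` Poly_Mapping.keys p))"

definition homogenize :: "'a::field mvpoly \<Rightarrow> 'a mvpoly" where
  "homogenize p = (\<Sum>m\<in>Poly_Mapping.keys p.
     Poly_Mapping.single (m + Poly_Mapping.single 0 (total_degree p - mon_degree m))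
       (Poly_Mapping.lookup p m))"

definition eval_mvpoly :: "'a::field mvpoly \<Rightarrow> (nat \<Rightarrow> 'a) \<Rightarrow> 'a" where
  "eval_mvpoly p x = (\<Sum>m\<in>Poly_Mapping.keys p.
     Poly_Mapping.lookup p m * (\<Prod>i\<in>Poly_Mapping.keys m. x i ^ Poly_Mapping.lookup m i))"

text \<open>The set of rational points of the hypersurface of \<open>PG(r, F)\<close> with affine equation
  \<open>p = 0\<close>, where \<open>p\<close> is a polynomial in \<open>X\<^sub>1, \<dots>, X\<^sub>r\<close> standing for the affine coordinates.\<close>

definition hypersurface :: "nat \<Rightarrow> 'a::field mvpoly \<Rightarrow> (nat \<Rightarrow> 'a) set set" where
  "hypersurface r p = {P \<in> PG r. \<forall>v\<in>P - {0}. eval_mvpoly (homogenize p) v = 0}"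

text \<open>For a finite field whose order is a power of \<open>q\<close>, this is its subfield with \<open>q\<close> elements.\<close>

definition subfield_of_order :: "nat \<Rightarrow> 'a::field set" where
  "subfield_of_order q = {x. x ^ q = x}"

text \<open>All powers are taken in the polynomial ring: exponents are not reduced modulo
  \<open>q\<^sup>2 - 1\<close>, so the degree used for homogenizing is the formal one.\<close>

definition Gamma_poly :: "nat \<Rightarrow> 'a::field \<Rightarrow> 'a mvpoly \<Rightarrow> 'a mvpoly" where
  "Gamma_poly e \<epsilon> x = (let q = 2 ^ e; \<sigma> = 2 ^ ((e + 1) div 2) in
     (x + (x ^ q + x) * Cst \<epsilon>) ^ (\<sigma> + 2) + (x ^ q + x) ^ \<sigma>
     + (x ^ (2 * q) + x\<^sup>2) * Cst \<epsilon> + x ^ (q + 1) + x\<^sup>2)"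

definition V_poly :: "nat \<Rightarrow> nat \<Rightarrow> 'a::field \<Rightarrow> 'a mvpoly" where
  "V_poly e r \<epsilon> = Var r ^ (2 ^ e) + Var r - (\<Sum>i = 1..r - 1. Gamma_poly e \<epsilon> (Var i))"

definition V_variety :: "nat \<Rightarrow> nat \<Rightarrow> 'a::field \<Rightarrow> (nat \<Rightarrow> 'a) set set" where
  "V_variety e r \<epsilon> = hypersurface r (V_poly e r \<epsilon>)"

definition linear_code :: "nat \<Rightarrow> (nat \<Rightarrow> 'a::field) set \<Rightarrow> bool" where
  "linear_code N C \<longleftrightarrow> fn.subspace C \<and> C \<subseteq> coord_space N"

text \<open>\<open>G i j\<close> is the entry in row \<open>i\<close> and column \<open>j\<close> of an \<open>(r + 1) \<times> |\<Omega>|\<close> matrix; the columns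
  represent the points of \<open>\<Omega>\<close>, each point exactly once.\<close>

definition point_matrix :: "nat \<Rightarrow> (nat \<Rightarrow> 'a::field) set set \<Rightarrow> (nat \<Rightarrow> nat \<Rightarrow> 'a) \<Rightarrow> bool" where
  "point_matrix r \<Omega> G \<longleftrightarrow>
     (\<forall>i j. i > r \<or> j \<ge> card \<Omega> \<longrightarrow> G i j = 0) \<and>
     bij_betw (\<lambda>j. fn.span {\<lambda>i. G i j}) {..<card \<Omega>} \<Omega>"

lemma point_matrix_exists:
  assumes fin: "finite \<Omega>" and sub: "\<Omega> \<subseteq> PG r"
  shows "\<exists>G. point_matrix r \<Omega> G"
proof -
  have "\<exists>v. v \<in> coord_space (Suc r) \<and> fn.span {v} = P" if P: "P \<in> \<Omega>" for P
  proof -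
    have P': "fn.subspace P" "P \<subseteq> coord_space (Suc r)" "fn.dim P = 1"
      using P sub by (auto simp: PG_def)
    obtain B where B: "B \<subseteq> P" "P \<subseteq> fn.span B" "card B = fn.dim P"
      using fn.basis_exists[of P] by metis
    then obtain v where v: "B = {v}" using P' by (metis card_1_singletonE)
    have "fn.span {v} = P" using B v P'(1) fn.span_minimal by blast
    thus ?thesis using B v P'(2) by blast
  qed
  then obtain v where v: "\<And>P. P \<in> \<Omega> \<Longrightarrow> v P \<in> coord_space (Suc r) \<and> fn.span {v P} = P"
    by metis
  obtain h where h: "bij_betw h {..<card \<Omega>} \<Omega>"
    using ex_bij_betw_nat_finite[OF fin] by (auto simp: atLeast0LessThan)
  define G where "G = (\<lambda>i j. if j < card \<Omega> then v (h j) i else 0)"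
  have hin: "h j \<in> \<Omega>" if "j < card \<Omega>" for j using h that by (auto simp: bij_betw_def)
  have "fn.span {\<lambda>i. G i j} = h j" if "j < card \<Omega>" for j
    using v[OF hin[OF that]] that by (simp add: G_def)
  hence "bij_betw (\<lambda>j. fn.span {\<lambda>i. G i j}) {..<card \<Omega>} \<Omega>"
    using h bij_betw_cong[of "{..<card \<Omega>}" "\<lambda>j. fn.span {\<lambda>i. G i j}" h \<Omega>] by simp
  moreover have "G i j = 0" if "i > r \<or> j \<ge> card \<Omega>" for i j
    using that v[OF hin[of j]] by (auto simp: G_def coord_space_def)
  ultimately show ?thesis unfolding point_matrix_def by blast
qed

definition row_code :: "nat \<Rightarrow> (nat \<Rightarrow> nat \<Rightarrow> 'a::field) \<Rightarrow> (nat \<Rightarrow> 'a) set" where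
  "row_code r G = fn.span (G ` {..r})"

definition min_distance :: "(nat \<Rightarrow> 'a::field) set \<Rightarrow> nat" where
  "min_distance C = Min {card {i. c i \<noteq> c' i} | c c'. c \<in> C \<and> c' \<in> C \<and> c \<noteq> c'}"

definition code_support :: "(nat \<Rightarrow> 'a::field) set \<Rightarrow> nat set" where
  "code_support D = (\<Union>c\<in>D. {i. c i \<noteq> 0})"

definition gen_hamming_weight :: "nat \<Rightarrow> (nat \<Rightarrow> 'a::field) set \<Rightarrow> nat" where
  "gen_hamming_weight m C =
     Min {card (code_support D) | D. fn.subspace D \<and> D \<subseteq> C \<and> fn.dim D = m}"

end

theory Submission
  imports Defs
begin

text \<open>
  Write \<open>K\<close> for the subfield with \<open>q\<close> elements. For \<open>a, b \<in> K\<close> the value \<open>\<Gamma> (a + b\<epsilon>)\<close> is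
  \<open>f a b = a\<^sup>\<sigma>\<^sup>+\<^sup>2 + ab + b\<^sup>\<sigma>\<close>, the function defining the Suzuki--Tits ovoid, and \<open>\<sigma>\<^sup>2\<close> acts on \<open>K\<close> as
  squaring. The bijections \<open>(a, b) \<mapsto> (a + \<alpha>, b + \<alpha>\<^sup>\<sigma>a + \<beta>)\<close> of \<open>K \<times> K\<close> absorb any linear form into \<open>f\<close>
  up to a constant, and the bijections
  \<open>(a, b) \<mapsto> (la, l\<^sup>\<sigma>\<^sup>+\<^sup>1b)\<close> permute the fibres of \<open>f\<close> over \<open>K - {0}\<close>; hence every such fibre has
  \<open>q + 1\<close> elements and the fibre over \<open>0\<close> has one. So a plane missing \<open>(0, 0, 0, 1)\<close> contains at
  most \<open>1 + (q\<^sup>2 - 1)(q + 1)\<close> affine points of the variety, and a plane through that point, other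
  than the plane at infinity, contains exactly \<open>q\<^sup>3\<close>.
  At infinity the variety is given by \<open>X\<^sub>1\<^sup>\<sigma>\<^sup>+\<^sup>2 = X\<^sub>2\<^sup>\<sigma>\<^sup>+\<^sup>2\<close>: at most three concurrent lines, because
  \<open>u\<^sup>\<sigma>\<^sup>+\<^sup>2 = 1\<close> forces \<open>u\<^sup>3 = 1\<close>. Thus a plane meets the variety in at most \<open>q\<^sup>3 + q\<^sup>2 + 1\<close>
  points, and \<open>X\<^sub>1 = X\<^sub>2\<close> attains this bound. An \<open>m\<close>-dimensional subcode vanishes on the columns in a
  subspace of codimension \<open>m\<close>, and for \<open>m \<ge> 2\<close> the extremal subspace lies in the variety.
\<close>

section \<open>Finite fields of characteristic two and the Tits ovoid function\<close>

text \<open>Adding 1 permutes the ring, so the sum of all elements does not change when 1 is added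
  to each of them.\<close>

lemma of_nat_card_UNIV_eq_0: "of_nat (card (UNIV :: 'a::{ring_1,finite} set)) = (0 :: 'a)"
proof -
  have "(\<Sum>x\<in>UNIV. x + 1 :: 'a) = (\<Sum>x\<in>UNIV. x)"
    by (rule sum.reindex_bij_witness[of _ "\<lambda>x. x - 1" "\<lambda>x. x + 1"]) auto
  thus ?thesis by (simp add: sum.distrib)
qed

text \<open>Multiplication by a nonzero \<open>x\<close> permutes the nonzero elements; comparing
  their products gives Fermat's identity.\<close>

lemma power_card_UNIV: "x ^ card (UNIV :: 'a set) = (x :: 'a::{field,finite})"
proof (cases "x = 0")
  case False
  have "(\<Prod>y\<in>UNIV-{0}. x * y) = (\<Prod>y\<in>UNIV-{0}. y)"
    by (rule prod.reindex_bij_witness[of _ "\<lambda>y. y / x" "\<lambda>y. x * y"]) (use False in auto)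
  hence "x ^ (card (UNIV :: 'a set) - 1) = 1"
    by (simp add: prod.distrib)
  hence "x ^ Suc (card (UNIV :: 'a set) - 1) = x" by simp
  moreover have "card (UNIV :: 'a set) > 0" by (simp add: finite_UNIV_card_ge_0)
  ultimately show ?thesis by simp
next
  case True
  thus ?thesis by (simp add: finite_UNIV_card_ge_0 zero_power)
qed

lemma power_two_power_add:
  assumes "(2 :: 'a::comm_ring_1) = 0"
  shows "(x + y :: 'a) ^ (2 ^ n) = x ^ (2 ^ n) + y ^ (2 ^ n)"
proof (induction n)
  case (Suc n)
  have "(a + b)\<^sup>2 = a\<^sup>2 + b\<^sup>2" for a b :: 'a
  proof -
    have "(a + b)\<^sup>2 = a\<^sup>2 + b\<^sup>2 + 2 * (a * b)"
      by (simp add: power2_eq_square algebra_simps)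
    thus ?thesis by (simp add: assms)
  qed
  thus ?case by (simp add: Suc power_mult mult.commute[of 2])
qed simp

lemma card_eq_sum_fibers:
  assumes "finite A" "finite B" "f ` A \<subseteq> B"
  shows "card A = (\<Sum>b\<in>B. card {a \<in> A. f a = b})"
proof -
  have "card A = (\<Sum>a\<in>A. \<Sum>b\<in>B. if f a = b then 1 else 0)"
    using assms by (simp add: image_subset_iff)
  also have "\<dots> = (\<Sum>b\<in>B. \<Sum>a\<in>A. if f a = b then 1 else 0)"
    by (rule sum.swap)
  also have "\<dots> = (\<Sum>b\<in>B. card {a \<in> A. f a = b})"
    using assms(1) by (simp add: sum.If_cases Int_def)
  finally show ?thesis .
qed

lemma card_pairs_eq_sum:
  assumes "finite A" "finite B"
  shows "card {p \<in> A \<times> B. P (fst p) (snd p)} = (\<Sum>b\<in>B. card {a \<in> A. P a b})"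
proof -
  have "card {p \<in> A \<times> B. P (fst p) (snd p)} = card (prod.swap ` (SIGMA b:B. {a \<in> A. P a b}))"
    by (rule arg_cong[where f = card]) (auto simp: image_iff)
  also have "\<dots> = card (SIGMA b:B. {a \<in> A. P a b})"
    by (rule card_image) (auto simp: inj_on_def)
  also have "\<dots> = (\<Sum>b\<in>B. card {a \<in> A. P a b})"
    using assms by (intro card_SigmaI) auto
  finally show ?thesis .
qed

text \<open>\<open>u^3 - 1\<close> factors as \<open>(u - 1) * (u^2 + u + 1)\<close>, and one root
  \<open>w\<close> of the quadratic factor leaves only \<open>-w - 1\<close> as a further
  root.\<close>

lemma card_cube_roots_of_unity: "card {u :: 'a::{field,finite}. u ^ 3 = 1} \<le> 3"
proof -
  let ?R = "{u :: 'a. u\<^sup>2 + u + 1 = 0}"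
  have fac: "u ^ 3 - 1 = (u - 1) * (u\<^sup>2 + u + 1)" for u :: 'a
    by (simp add: power2_eq_square power3_eq_cube algebra_simps)
  have "{u :: 'a. u ^ 3 = 1} \<subseteq> insert 1 ?R"
  proof
    fix u :: 'a assume "u \<in> {u. u ^ 3 = 1}"
    hence "(u - 1) * (u\<^sup>2 + u + 1) = 0" using fac[of u] by simp
    thus "u \<in> insert 1 ?R" by auto
  qed
  moreover have "card ?R \<le> 2"
  proof (cases "?R = {}")
    case False
    then obtain w :: 'a where w: "w\<^sup>2 + w + 1 = 0" by blast
    have "(u - w) * (u + w + 1) = 0" if "u\<^sup>2 + u + 1 = 0" for u :: 'a
    proof -
      have "(u - w) * (u + w + 1) = (u\<^sup>2 + u + 1) - (w\<^sup>2 + w + 1)"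
        by (simp add: power2_eq_square algebra_simps)
      thus ?thesis using that w by simp
    qed
    moreover have "u = - w - 1" if "u + w + 1 = 0" for u
      using that by (simp add: algebra_simps eq_neg_iff_add_eq_0)
    ultimately have "?R \<subseteq> {w, - w - 1}" by force
    hence "card ?R \<le> card {w, - w - 1}" by (intro card_mono) auto
    also have "\<dots> \<le> 2" by (simp add: card_insert_if)
    finally show ?thesis .
  next
    case True
    thus ?thesis by (simp only: card.empty)
  qed
  ultimately have "card {u :: 'a. u ^ 3 = 1} \<le> card (insert 1 ?R)" by (intro card_mono) auto
  thus ?thesis using \<open>card ?R \<le> 2\<close> by (simp add: card_insert_if split: if_splits)
qed

section \<open>The field of order q^2, its subfield K and the relative trace\<close>

locale suzuki_tits =
  fixes e q s :: nat and \<epsilon> \<delta> :: "'a::{field,finite}"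
  assumes odd_e: "odd e"
    and q_def: "q = 2 ^ e"
    and s_def: "s = 2 ^ ((e + 1) div 2)"
    and card_UNIV: "card (UNIV :: 'a set) = q\<^sup>2"
    and eps_notin: "\<epsilon> \<notin> subfield_of_order q"
    and delta_in: "\<delta> \<in> subfield_of_order q"
    and eps_eq: "\<epsilon>\<^sup>2 + \<epsilon> + \<delta> = 0"
begin

abbreviation K :: "'a set" where "K \<equiv> subfield_of_order q"

lemma q_ge_2: "q \<ge> 2"
  using odd_e unfolding q_def by (cases e) auto

lemma s_pos: "s > 0"
  by (simp add: s_def)

lemma two_eq_0 [simp]: "(2 :: 'a) = 0"
proof -
  have "(2 :: 'a) ^ (2 * e) = of_nat (q\<^sup>2)"
    by (simp only: q_def of_nat_power of_nat_numeral flip: power_mult) (simp add: mult.commute)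
  also have "\<dots> = 0" using of_nat_card_UNIV_eq_0[where 'a = 'a] by (simp only: card_UNIV)
  finally show ?thesis by simp
qed

lemma add_self [simp]: "x + x = (0 :: 'a)"
  by (metis mult_2 mult_zero_left two_eq_0)

lemma add_self_left [simp]: "x + (x + y) = (y :: 'a)"
  by (simp add: add.assoc[symmetric])

lemma minus_char_2 [simp]: "- x = (x :: 'a)"
  using add_self[of x] by (simp add: neg_eq_iff_add_eq_0)

lemma diff_char_2 [simp]: "x - y = (x + y :: 'a)"
  by (metis minus_char_2 diff_conv_add_uminus)

text \<open>As a simp rule this breaks up linear equations of the form \<open>... = 0\<close>; it is
  removed below wherever such an equation has to keep its shape.\<close>

lemma add_eq_0_iff_char_2 [simp]: "x + y = 0 \<longleftrightarrow> x = (y :: 'a)"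
  by (metis diff_char_2 eq_iff_diff_eq_0)

lemma power_q_add: "(x + y :: 'a) ^ q = x ^ q + y ^ q"
  unfolding q_def by (rule power_two_power_add) simp

lemma power_s_add: "(x + y :: 'a) ^ s = x ^ s + y ^ s"
  unfolding s_def by (rule power_two_power_add) simp

lemma power2_add: "(x + y :: 'a)\<^sup>2 = x\<^sup>2 + y\<^sup>2"
  using power_two_power_add[of x y 1] by simp

lemma power_q_q: "((x :: 'a) ^ q) ^ q = x"
  using power_card_UNIV[of x] by (simp add: card_UNIV power2_eq_square power_mult)

text \<open>For odd \<open>e\<close> the exponent \<open>(e + 1) div 2\<close> is an exact half, so
  \<open>s * s = 2^(e + 1)\<close>. Hence applying the power \<open>s\<close> twice is squaring on
  \<open>K\<close>, and \<open>x^(2 * q)\<close> on the whole field.\<close>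

lemma s_times_s: "s * s = q * 2"
proof -
  have "2 * ((e + 1) div 2) = e + 1" using odd_e by simp
  hence "s * s = 2 ^ (e + 1)" unfolding s_def by (metis mult_2 power_add)
  thus ?thesis by (simp add: q_def)
qed

lemma in_K_iff: "x \<in> K \<longleftrightarrow> x ^ q = x"
  by (simp add: subfield_of_order_def)

lemma K_add: "x \<in> K \<Longrightarrow> y \<in> K \<Longrightarrow> x + y \<in> K"
  by (simp add: in_K_iff power_q_add)

lemma K_mult: "x \<in> K \<Longrightarrow> y \<in> K \<Longrightarrow> x * y \<in> K"
  by (simp add: in_K_iff power_mult_distrib)

lemma K_divide: "x \<in> K \<Longrightarrow> y \<in> K \<Longrightarrow> x / y \<in> K"
  by (simp add: in_K_iff power_divide)

lemma K_power: "x \<in> K \<Longrightarrow> x ^ n \<in> K"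
  by (metis in_K_iff power_mult mult.commute)

lemma K_0: "0 \<in> K"
  using q_ge_2 by (simp add: in_K_iff)

lemma power_s_s: "x \<in> K \<Longrightarrow> (x ^ s) ^ s = x\<^sup>2"
  by (simp add: in_K_iff s_times_s power_mult flip: power_mult[of x s s])

text \<open>The relative trace from the field with q^2 elements to \<open>K\<close>; it is
  \<open>K\<close>-linear with kernel \<open>K\<close>.\<close>

definition tr :: "'a \<Rightarrow> 'a" where "tr x = x ^ q + x"

lemma tr_in_K: "tr x \<in> K"
  by (simp add: in_K_iff tr_def power_q_add power_q_q add.commute)

lemma tr_add: "tr (x + y) = tr x + tr y"
  by (simp add: tr_def power_q_add algebra_simps)

lemma tr_mult_K: "a \<in> K \<Longrightarrow> tr (a * x) = a * tr x"
  by (simp add: tr_def in_K_iff power_mult_distrib algebra_simps)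

lemma tr_K: "a \<in> K \<Longrightarrow> tr a = 0"
  by (simp add: tr_def in_K_iff)

lemma eps_sq: "\<epsilon>\<^sup>2 = \<epsilon> + \<delta>"
  using eps_eq by (simp add: add.assoc)

text \<open>The conjugate of \<epsilon> is a root of the same quadratic over \<open>K\<close>, whose
  roots are \<epsilon> and \<epsilon> + 1. It is not \<epsilon> itself, because \<epsilon> is
  outside \<open>K\<close>.\<close>

lemma eps_power_q: "\<epsilon> ^ q = \<epsilon> + 1"
proof -
  let ?n = "\<epsilon> ^ q"
  have "(\<epsilon>\<^sup>2) ^ q = (\<epsilon> + \<delta>) ^ q" by (simp add: eps_sq)
  hence n: "?n\<^sup>2 = ?n + \<delta>" using delta_in
    by (simp add: power_q_add in_K_iff flip: power_mult) (simp add: power_mult mult.commute)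
  have "(?n + \<epsilon>) * (?n + \<epsilon> + 1) = (?n + \<epsilon>)\<^sup>2 + (?n + \<epsilon>)"
    by (simp add: power2_eq_square algebra_simps)
  also have "\<dots> = 0" by (simp add: power2_add n eps_sq ac_simps)
  finally have "?n = \<epsilon> \<or> ?n + (\<epsilon> + 1) = 0"
    by (simp only: mult_eq_0_iff add.assoc) simp
  thus ?thesis using eps_notin by (simp add: in_K_iff)
qed

lemma tr_eps: "tr \<epsilon> = 1"
  by (simp add: tr_def eps_power_q ac_simps)

lemma eps_nonzero: "\<epsilon> \<noteq> 0"
  using eps_notin K_0 by metis

text \<open>1 and \<epsilon> form a \<open>K\<close>-basis. Since \<open>tr\<close> kills
  \<open>K\<close> and \<open>tr \<epsilon> = 1\<close>, the trace of \<open>x\<close> is its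
  \<epsilon>-coordinate, and \<open>x + tr x * \<epsilon>\<close> has trace 0 and so lies in
  \<open>K\<close>.\<close>

lemma bij_betw_K_K: "bij_betw (\<lambda>(a, b). a + b * \<epsilon>) (K \<times> K) UNIV"
  unfolding bij_betw_def
proof
  show "inj_on (\<lambda>(a, b). a + b * \<epsilon>) (K \<times> K)"
  proof (rule inj_onI, clarify)
    fix a b a' b' assume K: "a \<in> K" "b \<in> K" "a' \<in> K" "b' \<in> K"
      and eq: "a + b * \<epsilon> = a' + b' * \<epsilon>"
    have "tr (a + b * \<epsilon>) = tr (a' + b' * \<epsilon>)" by (simp only: eq)
    hence "b = b'" using K by (simp add: tr_add tr_mult_K tr_K tr_eps)
    thus "a = a' \<and> b = b'" using eq by simp
  qed
  have "x \<in> (\<lambda>(a, b). a + b * \<epsilon>) ` (K \<times> K)" for x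
  proof -
    have "tr (x + tr x * \<epsilon>) = 0" by (simp add: tr_add tr_mult_K tr_in_K tr_eps)
    hence "x + tr x * \<epsilon> \<in> K" by (simp add: in_K_iff tr_def)
    thus ?thesis by (intro image_eqI[of _ _ "(x + tr x * \<epsilon>, tr x)"]) (auto simp: tr_in_K add.assoc)
  qed
  thus "(\<lambda>(a, b). a + b * \<epsilon>) ` (K \<times> K) = UNIV" by blast
qed

lemma card_K: "card K = q"
proof -
  have "card K * card K = q\<^sup>2"
    using bij_betw_same_card[OF bij_betw_K_K] by (simp add: card_UNIV card_cartesian_product)
  thus ?thesis by (metis power2_eq_square power2_eq_iff_nonneg zero_le)
qed

lemma card_tr_fiber:
  assumes "t \<in> K"
  shows "card {x. tr x = t} = q"
proof -
  have "bij_betw (\<lambda>a. a + t * \<epsilon>) K {x. tr x = t}"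
    by (rule bij_betw_byWitness[where f' = "\<lambda>x. x + t * \<epsilon>"])
       (use assms in \<open>auto simp: tr_add tr_mult_K tr_K tr_eps add.assoc in_K_iff power_q_add
          eps_power_q tr_def algebra_simps\<close>)
  from bij_betw_same_card[OF this] show ?thesis by (simp add: card_K)
qed

section \<open>The function of the Suzuki-Tits ovoid and its fibres\<close>

definition \<Gamma> :: "'a \<Rightarrow> 'a" where
  "\<Gamma> x = (x + (x ^ q + x) * \<epsilon>) ^ (s + 2) + (x ^ q + x) ^ s
     + (x ^ (2 * q) + x\<^sup>2) * \<epsilon> + x ^ (q + 1) + x\<^sup>2"

definition f :: "'a \<Rightarrow> 'a \<Rightarrow> 'a" where
  "f a b = a ^ (s + 2) + a * b + b ^ s"

text \<open>For \<open>x = a + b * \<epsilon>\<close> the trace is \<open>b\<close> and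
  \<open>x + b * \<epsilon> = a\<close>, which gives the terms with exponent \<open>s\<close>. The
  remaining terms are \<open>b^2 * \<epsilon>\<close>, the norm
  \<open>a^2 + a * b + b^2 * \<delta>\<close> and
  \<open>x^2 = a^2 + b^2 * (\<epsilon> + \<delta>)\<close>; they cancel down to
  \<open>a * b\<close>.\<close>

lemma \<Gamma>_eq_f:
  assumes "a \<in> K" "b \<in> K"
  shows "\<Gamma> (a + b * \<epsilon>) = f a b"
proof -
  let ?x = "a + b * \<epsilon>"
  have xq: "?x ^ q = a + b * \<epsilon> + b"
    using assms by (simp add: power_q_add power_mult_distrib in_K_iff eps_power_q algebra_simps)
  have t: "?x ^ q + ?x = b" unfolding xq by (simp add: ac_simps)
  have l: "?x + b * \<epsilon> = a" by (simp add: ac_simps)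
  have d: "?x ^ (2 * q) + ?x\<^sup>2 = b\<^sup>2"
    by (simp only: power_mult mult.commute[of 2 q] t flip: power2_add)
  have n: "?x ^ (q + 1) = a\<^sup>2 + a * b + b\<^sup>2 * \<delta>"
  proof -
    have "?x ^ (q + 1) = ?x ^ q * ?x" by simp
    also have "\<dots> = (a + b * \<epsilon> + b) * ?x" by (simp only: xq)
    also have "\<dots> = a\<^sup>2 + a * b + b\<^sup>2 * (\<epsilon>\<^sup>2 + \<epsilon>)"
      by (simp add: power2_eq_square algebra_simps)
    also have "\<epsilon>\<^sup>2 + \<epsilon> = \<delta>" by (simp add: eps_sq ac_simps)
    finally show ?thesis .
  qed
  have x2: "?x\<^sup>2 = a\<^sup>2 + b\<^sup>2 * (\<epsilon> + \<delta>)"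
    by (simp add: power2_add power_mult_distrib eps_sq)
  have "\<Gamma> ?x = a ^ (s + 2) + b ^ s + b\<^sup>2 * \<epsilon> + (a\<^sup>2 + a * b + b\<^sup>2 * \<delta>)
      + (a\<^sup>2 + b\<^sup>2 * (\<epsilon> + \<delta>))"
    unfolding \<Gamma>_def d n t l by (simp only: x2)
  thus ?thesis unfolding f_def by (simp add: algebra_simps)
qed

lemma f_in_K: "a \<in> K \<Longrightarrow> b \<in> K \<Longrightarrow> f a b \<in> K"
  unfolding f_def by (simp only: K_add K_mult K_power)

lemma \<Gamma>_in_K: "\<Gamma> x \<in> K"
proof -
  have "x \<in> (\<lambda>(a, b). a + b * \<epsilon>) ` (K \<times> K)"
    using bij_betw_imp_surj_on[OF bij_betw_K_K] by simp
  thus ?thesis using \<Gamma>_eq_f f_in_K by auto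
qed

text \<open>The shear \<open>\<alpha>^s * a\<close> in the second argument produces
  \<open>\<alpha>^s * a^2\<close> in the product and, because
  \<open>(\<alpha>^s)^s = \<alpha>^2\<close>, \<open>\<alpha>^2 * a^s\<close> in the last power.
  These cancel the two mixed terms of \<open>(a + \<alpha>)^(s + 2)\<close>, so only linear terms
  and a constant are left.\<close>

lemma f_translate:
  assumes "\<alpha> \<in> K"
  shows "f (a + \<alpha>) (b + \<alpha> ^ s * a + \<beta>) = f a b + (\<beta> + \<alpha> ^ (s + 1)) * a + \<alpha> * b + f \<alpha> \<beta>"
  unfolding f_def
  by (simp add: power_add power_s_add power2_add power_mult_distrib power_s_s assms ac_simps
       distrib_left distrib_right power2_eq_square)

text \<open>On \<open>K\<close> one has \<open>(l^(s + 1))^s = l^(s + 2)\<close>, so all three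
  monomials of \<open>f\<close> have the same weight.\<close>

lemma f_scale:
  assumes "l \<in> K"
  shows "f (l * a) (l ^ (s + 1) * b) = l ^ (s + 2) * f a b"
  unfolding f_def
  by (simp add: power_add power_mult_distrib power_s_s assms ac_simps distrib_left power2_eq_square)

text \<open>If \<open>a\<close> is nonzero, scaling reduces to \<open>a = 1\<close> and a zero
  \<open>c\<close> with \<open>c^s = 1 + c\<close>. Applying the power \<open>s\<close> once more
  gives \<open>c^2 = c\<close>, but neither 0 nor 1 solves \<open>c^s = 1 + c\<close>.\<close>

lemma f_eq_0_iff:
  assumes "a \<in> K" "b \<in> K"
  shows "f a b = 0 \<longleftrightarrow> a = 0 \<and> b = 0"
proof
  assume f0: "f a b = 0"
  have "a = 0"
  proof (rule ccontr)
    assume a: "a \<noteq> 0"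
    define c where "c = b / a ^ (s + 1)"
    have cK: "c \<in> K" unfolding c_def by (intro K_divide K_power assms)
    have "f (a * 1) (a ^ (s + 1) * c) = 0" using a f0 by (simp add: c_def del: power_Suc)
    hence "f 1 c = 0" using f_scale[OF assms(1), of 1 c] a by simp
    hence c1: "c ^ s = 1 + c" by (simp add: f_def)
    have "c\<^sup>2 = (c ^ s) ^ s" using power_s_s[OF cK] by (rule sym)
    also have "\<dots> = 1 + c ^ s" by (simp only: c1 power_s_add power_one)
    also have "\<dots> = c" by (simp add: c1)
    finally have "c\<^sup>2 = c" .
    hence "c = 0 \<or> c = 1" by (simp add: power2_eq_square)
    thus False using c1 s_pos by (auto simp: zero_power)
  qed
  thus "a = 0 \<and> b = 0" using f0 s_pos by (auto simp: f_def)
qed (simp add: f_def s_pos)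

text \<open>Raising the hypothesis to the power \<open>s\<close> gives
  \<open>l^2 * (l^s)^2 = 1\<close>, squaring it gives \<open>(l^s)^2 * l^4 = 1\<close>. Comparison
  yields \<open>l^2 = 1\<close>, and squaring is injective in characteristic 2.\<close>

lemma power_s_plus_2_eq_1:
  assumes "l \<in> K" "l ^ (s + 2) = 1"
  shows "l = 1"
proof -
  have "(l ^ s * l\<^sup>2) ^ s = 1" using assms(2) by (simp only: power_add power_one)
  hence "(l ^ s) ^ s * (l ^ s)\<^sup>2 = 1"
    by (simp only: power_mult_distrib) (simp only: mult.commute flip: power_mult)
  hence "l\<^sup>2 * (l ^ s)\<^sup>2 = 1" by (simp only: power_s_s assms)
  moreover have "(l ^ s)\<^sup>2 * (l\<^sup>2)\<^sup>2 = 1"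
    using arg_cong[OF assms(2), of "\<lambda>x. x\<^sup>2"] by (simp only: power_add power_mult_distrib power_one)
  ultimately have "l\<^sup>2 = 1" by (metis mult.assoc mult.commute mult_1_right power2_eq_square)
  hence "(l + 1)\<^sup>2 = 0" by (simp add: power2_add)
  thus ?thesis by simp
qed

text \<open>The power map is an endomorphism of the finite group of nonzero elements of
  \<open>K\<close>, with trivial kernel; hence it is onto.\<close>

lemma ex_power_s_plus_2:
  assumes "t \<in> K" "t \<noteq> 0"
  shows "\<exists>l\<in>K - {0}. l ^ (s + 2) = t"
proof -
  let ?g = "\<lambda>l :: 'a. l ^ (s + 2)"
  have "inj_on ?g (K - {0})"
  proof (rule inj_onI)
    fix x y assume xy: "x \<in> K - {0}" "y \<in> K - {0}" "?g x = ?g y"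
    hence "(x / y) ^ (s + 2) = 1" by (simp add: power_divide)
    moreover have "x / y \<in> K" using xy by (simp add: K_divide)
    ultimately have "x / y = 1" by (simp only: power_s_plus_2_eq_1)
    thus "x = y" using xy by simp
  qed
  moreover have "?g ` (K - {0}) \<subseteq> K - {0}" by (auto simp: K_mult K_power)
  ultimately have "?g ` (K - {0}) = K - {0}" by (intro endo_inj_surj) auto
  thus ?thesis using assms by (metis (no_types, lifting) DiffI imageE singletonD)
qed

text \<open>Scaling by a root \<open>l\<close> of \<open>l^(s + 2) = t\<close> identifies the fibre
  over 1 with the fibre over \<open>t\<close>. The \<open>q - 1\<close> nonzero fibres share the
  \<open>q^2 - 1\<close> pairs other than \<open>(0, 0)\<close> equally.\<close>

lemma card_f_fiber:
  assumes "t \<in> K"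
  shows "card {p \<in> K \<times> K. f (fst p) (snd p) = t} = (if t = 0 then 1 else q + 1)"
proof -
  let ?F = "\<lambda>t. {p \<in> K \<times> K. f (fst p) (snd p) = t}"
  have F0: "?F 0 = {(0, 0)}" using f_eq_0_iff by (auto simp: K_0)
  have eq1: "card (?F t) = card (?F 1)" if t: "t \<in> K - {0}" for t
  proof -
    from t obtain l where l: "l \<in> K" "l \<noteq> 0" "l ^ (s + 2) = t"
      using ex_power_s_plus_2[of t] by auto
    have l': "f (l * a) (l ^ (s + 1) * b) = t * f a b" for a b
      using f_scale[OF l(1)] l(3) by simp
    have l'': "f (a / l) (b / l ^ (s + 1)) = 1" if "f a b = t" for a b
      using l'[of "a / l" "b / l ^ (s + 1)"] l(2) that t by simp
    have "bij_betw (\<lambda>(a, b). (l * a, l ^ (s + 1) * b)) (?F 1) (?F t)"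
    proof (rule bij_betw_byWitness[where f' = "\<lambda>(a, b). (a / l, b / l ^ (s + 1))"])
      show "(\<lambda>(a, b). (l * a, l ^ (s + 1) * b)) ` ?F 1 \<subseteq> ?F t"
        using l l' by (auto simp del: power_Suc intro!: K_mult K_power)
      show "(\<lambda>(a, b). (a / l, b / l ^ (s + 1))) ` ?F t \<subseteq> ?F 1"
        using l l'' by (auto simp del: power_Suc intro!: K_divide K_power)
    qed (use l in auto)
    thus ?thesis by (rule bij_betw_same_card[symmetric])
  qed
  have "q * q = card (K \<times> K)" by (simp add: card_cartesian_product card_K)
  also have "\<dots> = (\<Sum>t\<in>K. card (?F t))"
    by (rule card_eq_sum_fibers) (auto simp: f_in_K)
  also have "\<dots> = card (?F 0) + (\<Sum>t\<in>K - {0}. card (?F t))"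
    by (rule sum.remove) (auto simp: K_0)
  also have "(\<Sum>t\<in>K - {0}. card (?F t)) = (\<Sum>t\<in>K - {0}. card (?F 1))"
    by (rule sum.cong[OF refl], rule eq1)
  also have "\<dots> = (q - 1) * card (?F 1)" by (simp add: K_0 card_K)
  finally have eq: "q * q = 1 + (q - 1) * card (?F 1)" by (simp only: F0) simp
  \<comment> \<open>Writing \<open>q\<close> as \<open>k + 2\<close> turns the truncated
    \<open>q - 1\<close> into a successor, which can be cancelled.\<close>
  obtain k where k: "q = Suc (Suc k)" using q_ge_2 by (metis add_2_eq_Suc le_Suc_ex)
  define n where "n = card (?F 1)"
  have eq_n: "q * q = 1 + (q - 1) * n" unfolding n_def by (rule eq)
  have "Suc k * n = Suc k * (q + 1)" using eq_n by (simp add: k)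
  hence "n = q + 1" by (metis mult_left_cancel nat.distinct(2))
  moreover have "card (?F 0) = 1" by (simp only: F0) simp
  moreover have "card (?F t) = n" if "t \<noteq> 0"
    unfolding n_def by (rule eq1) (use that assms in blast)
  ultimately show ?thesis by (simp only: split: if_splits) blast
qed

end

lemma card_line_in_plane:
  fixes a b c :: "'a::{field,finite}"
  assumes "b \<noteq> 0 \<or> c \<noteq> 0"
  shows "card {p :: 'a \<times> 'a. a + b * fst p + c * snd p = 0} = card (UNIV :: 'a set)"
proof (cases "c = 0")
  case True
  hence b: "b \<noteq> 0" using assms by simp
  have eq: "a + b * x = 0 \<longleftrightarrow> x = - a / b" for x
    using b by (simp only: eq_divide_eq eq_neg_iff_add_eq_0 if_False if_True ac_simps simp_thms)
  have "{p :: 'a \<times> 'a. a + b * fst p + c * snd p = 0} = {- a / b} \<times> UNIV"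
    by (rule set_eqI) (simp only: True mult_zero_left add_0_right eq mem_Times_iff mem_Collect_eq
        singleton_iff UNIV_I simp_thms)
  thus ?thesis by (simp add: card_cartesian_product)
next
  case False
  have eq: "a + b * x + c * y = 0 \<longleftrightarrow> y = - (a + b * x) / c" for x y
    using False by (simp only: eq_divide_eq eq_neg_iff_add_eq_0 if_False if_True ac_simps simp_thms)
  have "{p :: 'a \<times> 'a. a + b * fst p + c * snd p = 0} = (\<lambda>x. (x, - (a + b * x) / c)) ` UNIV"
    by (simp only: eq image_def) (simp add: prod_eq_iff)
  thus ?thesis by (simp only:) (rule card_image, rule inj_onI, simp only: prod.inject)
qed

section \<open>Affine sections of the variety and the roots of unity occurring at infinity\<close>

context suzuki_tits
begin

lemma \<Gamma>_plus_linear: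
  "\<exists>g k. bij_betw g UNIV (K \<times> K) \<and> k \<in> K \<and>
     (\<forall>x. \<Gamma> x + tr (d * x) = f (fst (g x)) (snd (g x)) + k)"
proof -
  \<comment> \<open>For \<open>x = a + b * \<epsilon>\<close> one has
    \<open>tr (d * x) = tr d * a + tr (d * \<epsilon>) * b\<close>. The values of \<alpha> and
    \<beta> make the linear part in \<open>f_translate\<close> equal to this.\<close>
  define \<alpha> where "\<alpha> = tr (d * \<epsilon>)"
  define \<beta> where "\<beta> = tr d + \<alpha> ^ (s + 1)"
  have K: "\<alpha> \<in> K" "\<beta> \<in> K" unfolding \<alpha>_def \<beta>_def by (simp_all only: tr_in_K K_add K_power)
  define j where "j = (\<lambda>(a, b). a + b * \<epsilon>)"
  define h where "h = (\<lambda>(a, b). (a + \<alpha>, b + \<alpha> ^ s * a + \<beta>))"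
  have j: "bij_betw j (K \<times> K) UNIV" unfolding j_def by (rule bij_betw_K_K)
  have h: "bij_betw h (K \<times> K) (K \<times> K)" unfolding h_def
    by (rule bij_betw_byWitness[where f' = "\<lambda>(a, b). (a + \<alpha>, b + \<beta> + \<alpha> ^ s * (a + \<alpha>))"])
       (auto simp: K K_add K_mult K_power ac_simps)
  define g where "g = h \<circ> inv_into (K \<times> K) j"
  have "bij_betw g UNIV (K \<times> K)"
    unfolding g_def by (rule bij_betw_trans[OF bij_betw_inv_into[OF j] h])
  moreover have "\<Gamma> x + tr (d * x) = f (fst (g x)) (snd (g x)) + f \<alpha> \<beta>" for x
  proof -
    obtain a b where ab: "a \<in> K" "b \<in> K" "inv_into (K \<times> K) j x = (a, b)"
      using bij_betw_imp_surj_on[OF bij_betw_inv_into[OF j]] by (metis SigmaE UNIV_I image_eqI)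
    hence x: "x = a + b * \<epsilon>"
      using bij_betw_inv_into_right[OF j, of x] by (simp add: j_def)
    have "f (fst (g x)) (snd (g x)) + f \<alpha> \<beta>
        = f (a + \<alpha>) (b + \<alpha> ^ s * a + \<beta>) + f \<alpha> \<beta>"
      by (simp add: g_def h_def ab(3))
    also have "\<dots> = f a b + (\<beta> + \<alpha> ^ (s + 1)) * a + \<alpha> * b"
      using f_translate[OF K(1)] by (simp only: add.assoc add_self add_0_right)
    also have "\<beta> + \<alpha> ^ (s + 1) = tr d"
      unfolding \<beta>_def by (simp only: add.assoc add_self add_0_right)
    also have "tr d * a + \<alpha> * b = tr (d * x)"
    proof -
      have "tr (d * x) = tr (a * d + b * (d * \<epsilon>))" by (simp add: x algebra_simps)
      thus ?thesis by (simp only: tr_add tr_mult_K ab \<alpha>_def mult.commute)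
    qed
    hence "f a b + tr d * a + \<alpha> * b = f a b + tr (d * x)" by (simp only: add.assoc)
    finally show ?thesis using \<Gamma>_eq_f[OF ab(1,2)] by (simp only: x)
  qed
  moreover have "f \<alpha> \<beta> \<in> K" using K by (rule f_in_K)
  ultimately show ?thesis by blast
qed

text \<open>For a fixed \<open>p\<close> the admissible partners form the fibre of \<open>f\<close>
  over \<open>f p + k\<close>, which has 1 or \<open>q + 1\<close> elements. Some \<open>p0\<close>
  has \<open>f p0 = k\<close>, since no fibre is empty, and contributes only 1; the other
  \<open>q^2 - 1\<close> pairs contribute at most \<open>q + 1\<close> each.\<close>

lemma card_f_add_f_le:
  assumes "k \<in> K"
  shows "card {p \<in> (K \<times> K) \<times> (K \<times> K). f (fst (fst p)) (snd (fst p)) + f (fst (snd p)) (snd (snd p)) = k}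
     \<le> 1 + (q\<^sup>2 - 1) * (q + 1)"
proof -
  let ?f = "\<lambda>p. f (fst p) (snd p)"
  let ?n = "\<lambda>p. if ?f p = k then 1 else q + 1"
  have "card {p \<in> (K \<times> K) \<times> (K \<times> K). ?f (fst p) + ?f (snd p) = k}
      = (\<Sum>p\<in>K \<times> K. card {p' \<in> K \<times> K. ?f p' + ?f p = k})"
    by (rule card_pairs_eq_sum) auto
  also have "\<dots> = (\<Sum>p\<in>K \<times> K. ?n p)"
  proof (rule sum.cong[OF refl])
    fix p assume "p \<in> K \<times> K"
    hence pk: "?f p + k \<in> K" using assms by (auto simp: f_in_K K_add)
    have "?f p' + ?f p = k \<longleftrightarrow> ?f p' = ?f p + k" for p'
      by (metis add_self_left add.commute)
    thus "card {p' \<in> K \<times> K. ?f p' + ?f p = k} = ?n p"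
      using card_f_fiber[OF pk] by simp
  qed
  also have "\<dots> \<le> 1 + (q\<^sup>2 - 1) * (q + 1)"
  proof -
    have "card {p \<in> K \<times> K. ?f p = k} \<noteq> 0" using card_f_fiber[OF assms] by simp
    hence "{p \<in> K \<times> K. ?f p = k} \<noteq> {}" by (metis card.empty)
    then obtain p0 where p0: "p0 \<in> K \<times> K" "?f p0 = k" by blast
    have "(\<Sum>p\<in>K \<times> K. ?n p) = ?n p0 + (\<Sum>p\<in>K \<times> K - {p0}. ?n p)"
      using p0(1) by (intro sum.remove) auto
    also have "?n p0 = 1" using p0(2) by simp
    also have "(\<Sum>p\<in>K \<times> K - {p0}. ?n p) \<le> (\<Sum>p\<in>K \<times> K - {p0}. q + 1)"
      by (intro sum_mono) auto
    also have "\<dots> = (q\<^sup>2 - 1) * (q + 1)"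
      using p0(1) by (simp add: card_cartesian_product card_K power2_eq_square)
    finally show ?thesis by simp
  qed
  finally show ?thesis .
qed

text \<open>Affine points of a plane that does not contain the point \<open>(0, 0, 0, 1)\<close>, parametrized by
  their first two coordinates.\<close>

lemma card_affine_plane_section_le:
  "card {p. tr (d + d1 * fst p + d2 * snd p) = \<Gamma> (fst p) + \<Gamma> (snd p)} \<le> q ^ 3 + q\<^sup>2 - q"
proof -
  obtain g1 k1 where g1: "bij_betw g1 UNIV (K \<times> K)" "k1 \<in> K"
    "\<And>x. \<Gamma> x + tr (d1 * x) = f (fst (g1 x)) (snd (g1 x)) + k1" using \<Gamma>_plus_linear[of d1] by blast
  obtain g2 k2 where g2: "bij_betw g2 UNIV (K \<times> K)" "k2 \<in> K"
    "\<And>x. \<Gamma> x + tr (d2 * x) = f (fst (g2 x)) (snd (g2 x)) + k2" using \<Gamma>_plus_linear[of d2] by blast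
  define k where "k = k1 + k2 + tr d"
  have kK: "k \<in> K" unfolding k_def by (simp only: K_add g1 g2 tr_in_K)
  let ?S = "{p. tr (d + d1 * fst p + d2 * snd p) = \<Gamma> (fst p) + \<Gamma> (snd p)}"
  let ?T = "{p \<in> (K \<times> K) \<times> (K \<times> K). f (fst (fst p)) (snd (fst p)) + f (fst (snd p)) (snd (snd p)) = k}"
  have iff: "tr (d + d1 * x + d2 * y) = \<Gamma> x + \<Gamma> y \<longleftrightarrow>
      f (fst (g1 x)) (snd (g1 x)) + f (fst (g2 y)) (snd (g2 y)) = k" (is "?L \<longleftrightarrow> ?R") for x y
  proof -
    have "?L \<longleftrightarrow> tr (d + d1 * x + d2 * y) + (\<Gamma> x + \<Gamma> y) = 0" by (simp only: add_eq_0_iff_char_2)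
    also have "tr (d + d1 * x + d2 * y) + (\<Gamma> x + \<Gamma> y)
        = (\<Gamma> x + tr (d1 * x)) + (\<Gamma> y + tr (d2 * y)) + tr d"
      by (simp only: tr_add ac_simps)
    also have "\<dots> = (f (fst (g1 x)) (snd (g1 x)) + f (fst (g2 y)) (snd (g2 y))) + k"
      by (simp only: g1(3) g2(3) k_def ac_simps)
    also have "\<dots> = 0 \<longleftrightarrow> ?R" by (simp only: add_eq_0_iff_char_2)
    finally show ?thesis .
  qed
  have "inj_on (map_prod g1 g2) ?S"
    using g1(1) g2(1) by (auto simp: inj_on_def bij_betw_def)
  moreover have "map_prod g1 g2 ` ?S \<subseteq> ?T"
  proof -
    have "g1 x \<in> K \<times> K" "g2 x \<in> K \<times> K" for x
      using g1(1) g2(1) by (auto dest: bij_betwE)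
    thus ?thesis using iff by (auto simp: mem_Times_iff)
  qed
  ultimately have "card ?S \<le> card ?T" by (intro card_inj_on_le) auto
  also have "\<dots> \<le> 1 + (q\<^sup>2 - 1) * (q + 1)" by (rule card_f_add_f_le[OF kK])
  also have "\<dots> = q ^ 3 + q\<^sup>2 - q"
  proof -
    obtain k where "q = Suc k" using q_ge_2 by (cases q) auto
    thus ?thesis by (simp add: power2_eq_square power3_eq_cube algebra_simps)
  qed
  finally show ?thesis .
qed

text \<open>The values of \<Gamma> lie in \<open>K\<close>, so over each pair of first coordinates
  the trace equation has exactly \<open>q\<close> solutions. This serves for planes through
  \<open>(0, 0, 0, 1)\<close> and for the whole affine part.\<close>

lemma card_\<Gamma>_cylinder:
  "card {p. fst p \<in> A \<and> tr (snd p) = \<Gamma> (fst (fst p)) + \<Gamma> (snd (fst p))} = card A * q"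
proof -
  have "{p. fst p \<in> A \<and> tr (snd p) = \<Gamma> (fst (fst p)) + \<Gamma> (snd (fst p))}
      = (SIGMA p:A. {z. tr z = \<Gamma> (fst p) + \<Gamma> (snd p)})" by auto
  thus ?thesis by (simp add: card_tr_fiber K_add \<Gamma>_in_K)
qed

text \<open>Here \<open>u\<close> ranges over the whole field, where
  \<open>u^(s * s) = u^(2 * q)\<close>. From \<open>u^s = u^(-2)\<close> one gets
  \<open>u^(2 * q) = u^4\<close>, so \<open>u^q = u^2\<close>; applying the power \<open>q\<close>
  again gives \<open>u = u^4\<close>.\<close>

lemma card_roots_of_unity_le_3: "card {u :: 'a. u ^ (s + 2) = 1} \<le> 3"
proof -
  have "u ^ 3 = 1" if u: "u ^ (s + 2) = 1" for u :: 'a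
  proof -
    have u0: "u \<noteq> 0" using u by (auto simp: zero_power)
    have us: "u ^ s = inverse (u\<^sup>2)"
      using u u0 by (simp only: power_add) (metis inverse_unique mult.commute)
    have "u ^ (s * s) = inverse ((u ^ s)\<^sup>2)"
      by (metis us power_mult power_inverse mult.commute)
    also have "\<dots> = (u\<^sup>2)\<^sup>2" by (simp only: us power_inverse inverse_inverse_eq)
    finally have "(u ^ q)\<^sup>2 = (u\<^sup>2)\<^sup>2" by (simp only: s_times_s power_mult)
    hence "(u ^ q + u\<^sup>2)\<^sup>2 = 0" by (simp only: power2_add add_self)
    hence uq: "u ^ q = u\<^sup>2" by simp
    have "u = (u ^ q) ^ q" by (simp only: power_q_q)
    also have "\<dots> = (u ^ q)\<^sup>2" by (metis uq power_mult mult.commute)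
    also have "\<dots> = u * u ^ 3" by (simp add: uq power2_eq_square power3_eq_cube)
    finally have "u * 1 = u * u ^ 3" by simp
    thus ?thesis using u0 by (metis mult_left_cancel)
  qed
  hence "{u :: 'a. u ^ (s + 2) = 1} \<subseteq> {u. u ^ 3 = 1}" by blast
  hence "card {u :: 'a. u ^ (s + 2) = 1} \<le> card {u :: 'a. u ^ 3 = 1}" by (intro card_mono) auto
  thus ?thesis using card_cube_roots_of_unity order.trans by blast
qed

end

section \<open>Evaluation and homogenization of polynomials\<close>

definition mon_eval :: "(nat \<Rightarrow> 'a::field) \<Rightarrow> (nat \<Rightarrow>\<^sub>0 nat) \<Rightarrow> 'a" where
  "mon_eval v m = (\<Prod>i\<in>Poly_Mapping.keys m. v i ^ Poly_Mapping.lookup m i)"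

text \<open>Evaluation and extraction of the leading form are both of this kind.\<close>

definition lin_ext :: "((nat \<Rightarrow>\<^sub>0 nat) \<Rightarrow> 'a::field) \<Rightarrow> 'a mvpoly \<Rightarrow> 'a" where
  "lin_ext w p = (\<Sum>m\<in>Poly_Mapping.keys p. Poly_Mapping.lookup p m * w m)"

lemma eval_mvpoly_eq_lin_ext: "eval_mvpoly p v = lin_ext (mon_eval v) p"
  by (simp add: eval_mvpoly_def lin_ext_def mon_eval_def)

lemma mon_eval_superset:
  assumes "finite A" "Poly_Mapping.keys m \<subseteq> A"
  shows "mon_eval v m = (\<Prod>i\<in>A. v i ^ Poly_Mapping.lookup m i)"
  unfolding mon_eval_def using assms
  by (intro prod.mono_neutral_left) (auto simp: in_keys_iff)

lemma mon_degree_superset: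
  assumes "finite A" "Poly_Mapping.keys m \<subseteq> A"
  shows "mon_degree m = (\<Sum>i\<in>A. Poly_Mapping.lookup m i)"
  unfolding mon_degree_def using assms
  by (intro sum.mono_neutral_left) (auto simp: in_keys_iff)

lemma mon_eval_add: "mon_eval v (m + n) = mon_eval v m * mon_eval v n"
proof -
  let ?A = "Poly_Mapping.keys m \<union> Poly_Mapping.keys n"
  have "mon_eval v (m + n) = (\<Prod>i\<in>?A. v i ^ Poly_Mapping.lookup (m + n) i)"
    using keys_add[of m n] by (intro mon_eval_superset) auto
  also have "\<dots> = mon_eval v m * mon_eval v n"
    by (simp add: lookup_add power_add prod.distrib mon_eval_superset[of ?A])
  finally show ?thesis .
qed

lemma mon_degree_add: "mon_degree (m + n) = mon_degree m + mon_degree n"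
proof -
  let ?A = "Poly_Mapping.keys m \<union> Poly_Mapping.keys n"
  have "mon_degree (m + n) = (\<Sum>i\<in>?A. Poly_Mapping.lookup (m + n) i)"
    using keys_add[of m n] by (intro mon_degree_superset) auto
  also have "\<dots> = mon_degree m + mon_degree n"
    by (simp add: lookup_add sum.distrib mon_degree_superset[of ?A])
  finally show ?thesis .
qed

lemma mon_eval_single: "mon_eval v (Poly_Mapping.single i n) = v i ^ n"
  by (simp add: mon_eval_def)

lemma mon_degree_single: "mon_degree (Poly_Mapping.single i n) = n"
  by (simp add: mon_degree_def)

lemma mon_eval_0: "mon_eval v 0 = 1" and mon_degree_0: "mon_degree 0 = 0"
  by (simp_all add: mon_eval_def mon_degree_def)

lemma mon_eval_scale: "mon_eval (\<lambda>i. c * v i) m = c ^ mon_degree m * mon_eval v m"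
  by (simp add: mon_eval_def mon_degree_def power_mult_distrib prod.distrib power_sum)

lemma lin_ext_add: "lin_ext w (p + q) = lin_ext w p + lin_ext w q"
  unfolding lin_ext_def by (rule setsum_keys_plus_distrib) (auto simp: distrib_right)

lemma lin_ext_diff: "lin_ext w (p - q) = lin_ext w p - lin_ext w q"
  using lin_ext_add[of w "p - q" q] by simp

lemma lin_ext_0: "lin_ext w 0 = 0"
  by (simp add: lin_ext_def)

lemma lin_ext_sum: "lin_ext w (sum p A) = (\<Sum>a\<in>A. lin_ext w (p a))"
  by (induction A rule: infinite_finite_induct) (simp_all add: lin_ext_0 lin_ext_add)

lemma lin_ext_single: "lin_ext w (Poly_Mapping.single m c) = c * w m"
  by (simp add: lin_ext_def)

lemma mvpoly_as_sum:
  "(\<Sum>m\<in>Poly_Mapping.keys p. Poly_Mapping.single m (Poly_Mapping.lookup p m)) = (p :: 'a::field mvpoly)"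
proof (rule poly_mapping_eqI)
  fix k
  have "(\<Sum>m\<in>Poly_Mapping.keys p. Poly_Mapping.lookup p m when m = k) = Poly_Mapping.lookup p k"
    by (cases "k \<in> Poly_Mapping.keys p") (auto simp: when_def in_keys_iff)
  thus "Poly_Mapping.lookup (\<Sum>m\<in>Poly_Mapping.keys p. Poly_Mapping.single m (Poly_Mapping.lookup p m)) k
      = Poly_Mapping.lookup p k"
    by (simp add: lookup_sum lookup_single)
qed

lemma lin_ext_mult:
  "lin_ext w (p * q) = (\<Sum>m\<in>Poly_Mapping.keys p. \<Sum>n\<in>Poly_Mapping.keys q.
     Poly_Mapping.lookup p m * Poly_Mapping.lookup q n * w (m + n))"
proof -
  have "lin_ext w (p * q) = lin_ext w
      ((\<Sum>m\<in>Poly_Mapping.keys p. Poly_Mapping.single m (Poly_Mapping.lookup p m)) *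
       (\<Sum>n\<in>Poly_Mapping.keys q. Poly_Mapping.single n (Poly_Mapping.lookup q n)))"
    by (simp only: mvpoly_as_sum)
  thus ?thesis by (simp only: sum_product lin_ext_sum mult_single lin_ext_single)
qed

text \<open>Multiplicativity is required only on the monomials that occur, because the weight
  selecting monomials of top degree is multiplicative only under degree bounds on the
  factors.\<close>

lemma lin_ext_mult_eq:
  assumes "\<And>m n. m \<in> Poly_Mapping.keys p \<Longrightarrow> n \<in> Poly_Mapping.keys q \<Longrightarrow> w (m + n) = u m * v n"
  shows "lin_ext w (p * q) = lin_ext u p * lin_ext v q"
proof -
  have "lin_ext w (p * q) = (\<Sum>m\<in>Poly_Mapping.keys p. \<Sum>n\<in>Poly_Mapping.keys q.
      (Poly_Mapping.lookup p m * u m) * (Poly_Mapping.lookup q n * v n))"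
    unfolding lin_ext_mult by (intro sum.cong refl) (simp add: assms ac_simps)
  thus ?thesis by (simp add: lin_ext_def sum_product)
qed

lemma eval_add: "eval_mvpoly (p + q) v = eval_mvpoly p v + eval_mvpoly q v"
  and eval_diff: "eval_mvpoly (p - q) v = eval_mvpoly p v - eval_mvpoly q v"
  and eval_mult: "eval_mvpoly (p * q) v = eval_mvpoly p v * eval_mvpoly q v"
  by (simp_all add: eval_mvpoly_eq_lin_ext lin_ext_add lin_ext_diff lin_ext_mult_eq mon_eval_add)

lemma eval_Cst: "eval_mvpoly (Cst c) v = c" and eval_Var: "eval_mvpoly (Var i) v = v i"
  by (simp_all add: eval_mvpoly_eq_lin_ext Cst_def Var_def lin_ext_single mon_eval_single mon_eval_0)

lemma Cst_1: "Cst 1 = 1"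
  by (simp add: Cst_def)

lemma eval_power: "eval_mvpoly (p ^ n) v = eval_mvpoly p v ^ n"
  by (induction n) (simp_all add: eval_mult eval_Cst flip: Cst_1)

text \<open>The value of the homogenization is a linear functional of \<open>p\<close> itself, so
  the monomials of \<open>homogenize p\<close> need not be determined.\<close>

lemma eval_homogenize:
  "eval_mvpoly (homogenize p) v =
     lin_ext (\<lambda>m. mon_eval v m * v 0 ^ (total_degree p - mon_degree m)) p"
  unfolding eval_mvpoly_eq_lin_ext homogenize_def lin_ext_sum lin_ext_single mon_eval_add mon_eval_single
  by (simp add: lin_ext_def)

lemma mon_degree_le_total_degree:
  "m \<in> Poly_Mapping.keys p \<Longrightarrow> mon_degree m \<le> total_degree p"
  unfolding total_degree_def by (intro Max_ge) auto

lemma lin_ext_scale: "lin_ext (\<lambda>m. c * w m) p = c * lin_ext w p"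
  by (simp add: lin_ext_def sum_distrib_left ac_simps)

lemma lin_ext_cong:
  "(\<And>m. m \<in> Poly_Mapping.keys p \<Longrightarrow> w m = w' m) \<Longrightarrow> lin_ext w p = lin_ext w' p"
  by (simp add: lin_ext_def)

lemma eval_homogenize_affine:
  assumes "v 0 \<noteq> 0"
  shows "eval_mvpoly (homogenize p) v = v 0 ^ total_degree p * eval_mvpoly p (\<lambda>i. v i / v 0)"
proof -
  have eq: "mon_eval v m * v 0 ^ (total_degree p - mon_degree m)
      = v 0 ^ total_degree p * mon_eval (\<lambda>i. v i / v 0) m" if "m \<in> Poly_Mapping.keys p" for m
  proof -
    have "mon_eval v m = v 0 ^ mon_degree m * mon_eval (\<lambda>i. v i / v 0) m"
      using mon_eval_scale[of "v 0" "\<lambda>i. v i / v 0" m] assms by simp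
    moreover have "v 0 ^ total_degree p = v 0 ^ mon_degree m * v 0 ^ (total_degree p - mon_degree m)"
      using mon_degree_le_total_degree[OF that] by (simp flip: power_add)
    ultimately show ?thesis by simp
  qed
  show ?thesis
    unfolding eval_homogenize unfolding eval_mvpoly_eq_lin_ext lin_ext_scale[symmetric]
    by (rule lin_ext_cong[OF eq])
qed

text \<open>Homogeneity: vanishing does not depend on the coordinate vector representing a
  projective point.\<close>

lemma eval_homogenize_scale:
  "eval_mvpoly (homogenize p) (\<lambda>i. c * v i) = c ^ total_degree p * eval_mvpoly (homogenize p) v"
proof -
  have eq: "mon_eval (\<lambda>i. c * v i) m * (c * v 0) ^ (total_degree p - mon_degree m)
      = c ^ total_degree p * (mon_eval v m * v 0 ^ (total_degree p - mon_degree m))"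
    if "m \<in> Poly_Mapping.keys p" for m
  proof -
    have "c ^ total_degree p = c ^ mon_degree m * c ^ (total_degree p - mon_degree m)"
      using mon_degree_le_total_degree[OF that] by (simp flip: power_add)
    thus ?thesis by (simp add: mon_eval_scale power_mult_distrib)
  qed
  show ?thesis
    unfolding eval_homogenize lin_ext_scale[symmetric] by (rule lin_ext_cong[OF eq])
qed

text \<open>\<open>lead_form v p D c\<close>: the polynomial \<open>p\<close> has degree at most \<open>D\<close>, and its homogeneous part of
  degree \<open>D\<close> (possibly zero) takes the value \<open>c\<close> at \<open>v\<close>.\<close>

definition lead_form :: "(nat \<Rightarrow> 'a::field) \<Rightarrow> 'a mvpoly \<Rightarrow> nat \<Rightarrow> 'a \<Rightarrow> bool" where
  "lead_form v p D c \<longleftrightarrow> (\<forall>m\<in>Poly_Mapping.keys p. mon_degree m \<le> D) \<and>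
     lin_ext (\<lambda>m. if mon_degree m = D then mon_eval v m else 0) p = c"

lemma lead_form_add:
  "lead_form v p D a \<Longrightarrow> lead_form v q D b \<Longrightarrow> lead_form v (p + q) D (a + b)"
  using keys_add[of p q] by (auto simp: lead_form_def lin_ext_add)

lemma lead_form_diff:
  "lead_form v p D a \<Longrightarrow> lead_form v q D b \<Longrightarrow> lead_form v (p - q) D (a - b)"
  using keys_diff[of p q] by (auto simp: lead_form_def lin_ext_diff)

lemma lead_form_mult:
  assumes "lead_form v p A a" "lead_form v q B b"
  shows "lead_form v (p * q) (A + B) (a * b)"
proof -
  have deg: "mon_degree m \<le> A" "mon_degree n \<le> B"
    if "m \<in> Poly_Mapping.keys p" "n \<in> Poly_Mapping.keys q" for m n
    using assms that by (auto simp: lead_form_def)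
  have "\<forall>m\<in>Poly_Mapping.keys (p * q). mon_degree m \<le> A + B"
    using keys_mult[of p q] deg by (fastforce simp: mon_degree_add intro: add_mono)
  moreover have "lin_ext (\<lambda>m. if mon_degree m = A + B then mon_eval v m else 0) (p * q) =
      lin_ext (\<lambda>m. if mon_degree m = A then mon_eval v m else 0) p *
      lin_ext (\<lambda>m. if mon_degree m = B then mon_eval v m else 0) q"
  proof (rule lin_ext_mult_eq)
    fix m n assume "m \<in> Poly_Mapping.keys p" "n \<in> Poly_Mapping.keys q"
    from deg[OF this] show "(if mon_degree (m + n) = A + B then mon_eval v (m + n) else 0) =
        (if mon_degree m = A then mon_eval v m else 0) * (if mon_degree n = B then mon_eval v n else 0)"
      by (auto simp: mon_degree_add mon_eval_add)
  qed
  ultimately show ?thesis using assms by (simp add: lead_form_def)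
qed

lemma lead_form_Cst: "lead_form v (Cst c) 0 c"
  by (auto simp: lead_form_def Cst_def lin_ext_single mon_degree_0 mon_eval_0)

lemma lead_form_Var: "lead_form v (Var i) 1 (v i)"
  by (auto simp: lead_form_def Var_def lin_ext_single mon_degree_single mon_eval_single)

lemma lead_form_power: "lead_form v p A a \<Longrightarrow> lead_form v (p ^ n) (n * A) (a ^ n)"
proof (induction n)
  case 0
  show ?case using lead_form_Cst[of v 1] by (simp add: Cst_1)
next
  case (Suc n)
  thus ?case using lead_form_mult[of v p A a "p ^ n" "n * A" "a ^ n"] by simp
qed

text \<open>Summands of smaller degree can thus be added in at a common larger degree, where they
  contribute 0.\<close>

lemma lead_form_lower:
  assumes "lead_form v p A a" "A < D"
  shows "lead_form v p D 0"
proof -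
  have "mon_degree m < D" if "m \<in> Poly_Mapping.keys p" for m
    using assms that by (auto simp: lead_form_def)
  moreover from this have "lin_ext (\<lambda>m. if mon_degree m = D then mon_eval v m else 0) p = lin_ext (\<lambda>m. 0) p"
    by (intro lin_ext_cong) auto
  ultimately show ?thesis by (auto simp: lead_form_def lin_ext_def intro: less_imp_le)
qed

text \<open>One vector with a nonzero value certifies that the part of degree \<open>D\<close> does
  not cancel.\<close>

lemma total_degree_eq:
  assumes "lead_form v p D c" "c \<noteq> 0"
  shows "total_degree p = D"
proof -
  have le: "\<forall>m\<in>Poly_Mapping.keys p. mon_degree m \<le> D" using assms(1) by (simp add: lead_form_def)
  have "\<exists>m\<in>Poly_Mapping.keys p. mon_degree m = D"
  proof (rule ccontr)
    assume "\<not> ?thesis"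
    hence "lin_ext (\<lambda>m. if mon_degree m = D then mon_eval v m else 0) p = lin_ext (\<lambda>m. 0) p"
      by (intro lin_ext_cong) auto
    thus False using assms by (simp add: lead_form_def lin_ext_def)
  qed
  thus ?thesis unfolding total_degree_def using le by (intro Max_eqI) auto
qed

text \<open>At \<open>v 0 = 0\<close> each monomial that was padded by a positive power of the
  coordinate 0 vanishes, leaving those of full degree.\<close>

lemma eval_homogenize_infinity:
  assumes "v 0 = 0" "lead_form v p (total_degree p) c"
  shows "eval_mvpoly (homogenize p) v = c"
proof -
  have "eval_mvpoly (homogenize p) v
      = lin_ext (\<lambda>m. if mon_degree m = total_degree p then mon_eval v m else 0) p"
    unfolding eval_homogenize
    by (rule lin_ext_cong) (use mon_degree_le_total_degree[of _ p] assms(1) in \<open>fastforce simp: le_less\<close>)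
  thus ?thesis using assms(2) by (simp add: lead_form_def)
qed

section \<open>Degree of the defining polynomial and its form at infinity\<close>

context suzuki_tits
begin

lemma eval_Gamma_poly: "eval_mvpoly (Gamma_poly e \<epsilon> (Var i)) v = \<Gamma> (v i)"
  unfolding Gamma_poly_def \<Gamma>_def Let_def q_def[symmetric] s_def[symmetric]
  by (simp only: eval_add eval_mult eval_power eval_Var eval_Cst)

lemma eval_V_poly: "eval_mvpoly (V_poly e 3 \<epsilon>) v = tr (v 3) - (\<Gamma> (v 1) + \<Gamma> (v 2))"
proof -
  have "{1..3 - 1} = {1, 2 :: nat}" by auto
  thus ?thesis unfolding V_poly_def tr_def q_def[symmetric]
    by (simp only: eval_add eval_diff eval_power eval_Var) (simp add: eval_add eval_Gamma_poly)
qed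

text \<open>Only the first summand reaches degree \<open>(s + 2) * q\<close>; the others have degree
  at most \<open>s * q\<close>, \<open>2 * q\<close>, \<open>q + 1\<close> and 2.\<close>

lemma lead_form_Gamma_poly:
  "lead_form v (Gamma_poly e \<epsilon> (Var i)) ((s + 2) * q) ((v i ^ q * \<epsilon>) ^ (s + 2))"
proof -
  note V = lead_form_Var[of v i]
  have q1: "1 < q" using q_ge_2 by simp
  have "lead_form v (Var i) q 0" by (rule lead_form_lower[OF V q1])
  moreover have "lead_form v (Var i ^ q) q (v i ^ q)"
    using lead_form_power[OF V, of q] by simp
  ultimately have t: "lead_form v (Var i ^ q + Var i) q (v i ^ q)"
    using lead_form_add by fastforce
  have "lead_form v ((Var i ^ q + Var i) * Cst \<epsilon>) q (v i ^ q * \<epsilon>)"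
    using lead_form_mult[OF t lead_form_Cst[of v \<epsilon>]] by simp
  hence "lead_form v (Var i + (Var i ^ q + Var i) * Cst \<epsilon>) q (0 + v i ^ q * \<epsilon>)"
    by (intro lead_form_add lead_form_lower[OF V q1])
  hence T: "lead_form v ((Var i + (Var i ^ q + Var i) * Cst \<epsilon>) ^ (s + 2)) ((s + 2) * q)
      ((v i ^ q * \<epsilon>) ^ (s + 2))"
    by (intro lead_form_power) simp
  have l1: "lead_form v ((Var i ^ q + Var i) ^ s) ((s + 2) * q) 0"
    by (rule lead_form_lower[OF lead_form_power[OF t]]) (use q1 in simp)
  have V2: "lead_form v ((Var i)\<^sup>2) (2 * q) 0"
    by (rule lead_form_lower[OF lead_form_power[OF V]]) (use q1 in simp)
  have "lead_form v (Var i ^ (2 * q)) (2 * q) (v i ^ (2 * q))"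
    using lead_form_power[OF V, of "2 * q"] by simp
  from lead_form_mult[OF lead_form_add[OF this V2] lead_form_Cst[of v \<epsilon>]]
  have l2: "lead_form v ((Var i ^ (2 * q) + (Var i)\<^sup>2) * Cst \<epsilon>) ((s + 2) * q) 0"
    by (rule lead_form_lower) (use q1 s_pos in simp)
  have l3: "lead_form v (Var i ^ (q + 1)) ((s + 2) * q) 0"
    by (rule lead_form_lower[OF lead_form_power[OF V]]) (use q1 in simp)
  have l4: "lead_form v ((Var i)\<^sup>2) ((s + 2) * q) 0"
    by (rule lead_form_lower[OF V2]) (use q1 s_pos in simp)
  show ?thesis
    using lead_form_add[OF lead_form_add[OF lead_form_add[OF lead_form_add[OF T l1] l2] l3] l4]
    unfolding Gamma_poly_def Let_def q_def[symmetric] s_def[symmetric] by (simp only: add_0_right)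
qed

text \<open>The terms in the third variable have degree at most \<open>q\<close> and drop out.
  Additivity of the power \<open>q\<close> gathers the two contributions into one
  \<open>q\<close>-th power, so that the vanishing condition loses the exponent
  \<open>q\<close>.\<close>

lemma lead_form_V_poly:
  "lead_form v (V_poly e 3 \<epsilon>) ((s + 2) * q) (((v 1 ^ (s + 2) + v 2 ^ (s + 2)) ^ q) * \<epsilon> ^ (s + 2))"
proof -
  have q1: "1 < q" using q_ge_2 by simp
  have eq: "{1..3 - 1} = {1, 2 :: nat}" by auto
  have "lead_form v (Var 3) ((s + 2) * q) 0"
    by (rule lead_form_lower[OF lead_form_Var]) (use q1 in \<open>simp add: one_less_mult\<close>)
  moreover have "lead_form v (Var 3 ^ q) ((s + 2) * q) 0"
    by (rule lead_form_lower[OF lead_form_power[OF lead_form_Var]]) (use q1 in simp)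
  ultimately have "lead_form v (Var 3 ^ q + Var 3) ((s + 2) * q) (0 + 0)"
    by (intro lead_form_add)
  from lead_form_diff[OF this lead_form_add[OF lead_form_Gamma_poly[of v 1] lead_form_Gamma_poly[of v 2]]]
  have "lead_form v (V_poly e 3 \<epsilon>) ((s + 2) * q)
      (0 + 0 - ((v 1 ^ q * \<epsilon>) ^ (s + 2) + (v 2 ^ q * \<epsilon>) ^ (s + 2)))"
    unfolding V_poly_def q_def[symmetric] eq by simp
  moreover have "0 + 0 - ((v 1 ^ q * \<epsilon>) ^ (s + 2) + (v 2 ^ q * \<epsilon>) ^ (s + 2)) =
      ((v 1 ^ (s + 2) + v 2 ^ (s + 2)) ^ q) * \<epsilon> ^ (s + 2)"
    unfolding power_q_add power_mult_distrib diff_char_2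
    by (simp only: power_mult[symmetric] mult.commute[of q] add_0_left distrib_right)
  ultimately show ?thesis by simp
qed

lemma total_degree_V_poly: "total_degree (V_poly e 3 \<epsilon>) = (s + 2) * q"
  \<comment> \<open>At this unit vector the leading form takes the value
    \<open>\<epsilon>^(s + 2)\<close>, which is nonzero.\<close>
  by (rule total_degree_eq[OF lead_form_V_poly[of "\<lambda>i. if i = 1 then 1 else 0"]])
     (use eps_nonzero q_ge_2 in simp)

definition cone_eq :: "(nat \<Rightarrow> 'a) \<Rightarrow> bool" where
  "cone_eq v \<longleftrightarrow> eval_mvpoly (homogenize (V_poly e 3 \<epsilon>)) v = 0"

lemma cone_eq_affine:
  assumes "v 0 \<noteq> 0"
  shows "cone_eq v \<longleftrightarrow> tr (v 3 / v 0) = \<Gamma> (v 1 / v 0) + \<Gamma> (v 2 / v 0)"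
  unfolding cone_eq_def eval_homogenize_affine[of v, OF assms] eval_V_poly using assms by simp

lemma cone_eq_infinity:
  assumes "v 0 = 0"
  shows "cone_eq v \<longleftrightarrow> v 1 ^ (s + 2) = v 2 ^ (s + 2)"
proof -
  have "eval_mvpoly (homogenize (V_poly e 3 \<epsilon>)) v
      = ((v 1 ^ (s + 2) + v 2 ^ (s + 2)) ^ q) * \<epsilon> ^ (s + 2)"
    by (rule eval_homogenize_infinity[of v, OF assms], unfold total_degree_V_poly, rule lead_form_V_poly)
  thus ?thesis unfolding cone_eq_def using eps_nonzero q_ge_2 by (simp del: power_Suc)
qed

end

section \<open>Projective codes over finite fields\<close>

lemma scale_fun_apply: "scale_fun c v i = c * v i"
  by (simp add: scale_fun_def)

lemma subspace_coord_space: "fn.subspace (coord_space n)"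
  by (rule fn.subspaceI) (auto simp: coord_space_def scale_fun_apply)

lemma coord_space_Suc:
  "coord_space (Suc n) = (\<lambda>(c, v :: nat \<Rightarrow> 'a::field). v(n := c)) ` (UNIV \<times> coord_space n)"
  (is "?L = ?R")
proof
  show "?L \<subseteq> ?R"
  proof
    fix v :: "nat \<Rightarrow> 'a" assume "v \<in> ?L"
    hence "v(n := 0) \<in> coord_space n" by (auto simp: coord_space_def)
    thus "v \<in> ?R" by (intro image_eqI[of _ _ "(v n, v(n := 0))"]) auto
  qed
  show "?R \<subseteq> ?L" by (auto simp: coord_space_def)
qed

lemma card_coord_space:
  "finite (coord_space n :: (nat \<Rightarrow> 'a::{field,finite}) set)"
  "card (coord_space n :: (nat \<Rightarrow> 'a) set) = card (UNIV :: 'a set) ^ n"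
proof (induction n)
  case 0
  have "coord_space 0 = {0 :: nat \<Rightarrow> 'a}" by (auto simp: coord_space_def fun_eq_iff)
  thus "finite (coord_space 0 :: (nat \<Rightarrow> 'a) set)"
    "card (coord_space 0 :: (nat \<Rightarrow> 'a) set) = card (UNIV :: 'a set) ^ 0" by simp_all
next
  case (Suc n)
  have "inj_on (\<lambda>(c, v). v(n := c)) (UNIV \<times> (coord_space n :: (nat \<Rightarrow> 'a) set))"
  proof (rule inj_onI, clarify)
    fix c c' and v v' :: "nat \<Rightarrow> 'a"
    assume vv: "v \<in> coord_space n" "v' \<in> coord_space n" and eq: "v(n := c) = v'(n := c')"
    have "v i = v' i" for i
      using fun_cong[OF eq, of i] vv by (cases "i = n") (auto simp: coord_space_def)
    thus "c = c' \<and> v = v'" using fun_cong[OF eq, of n] by auto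
  qed
  thus "card (coord_space (Suc n) :: (nat \<Rightarrow> 'a) set) = card (UNIV :: 'a set) ^ Suc n"
    unfolding coord_space_Suc by (simp add: card_image card_cartesian_product Suc)
  show "finite (coord_space (Suc n) :: (nat \<Rightarrow> 'a) set)"
    unfolding coord_space_Suc using Suc by (intro finite_imageI finite_cartesian_product) auto
qed

lemma card_span_independent:
  fixes B :: "(nat \<Rightarrow> 'a::{field,finite}) set"
  assumes "finite B" "fn.independent B"
  shows "card (fn.span B) = card (UNIV :: 'a set) ^ card B"
  using assms
proof (induction B)
  case (insert b B)
  hence b: "b \<notin> fn.span B" and ind: "fn.independent B"
    using fn.independent_insert[of b B] by auto
  let ?h = "\<lambda>(c, v). scale_fun c b + v"
  have "fn.span (insert b B) = ?h ` (UNIV \<times> fn.span B)"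
  proof
    show "fn.span (insert b B) \<subseteq> ?h ` (UNIV \<times> fn.span B)"
    proof
      fix x assume "x \<in> fn.span (insert b B)"
      then obtain k where "x - scale_fun k b \<in> fn.span B" by (auto simp: fn.span_insert)
      thus "x \<in> ?h ` (UNIV \<times> fn.span B)"
        by (intro image_eqI[of _ _ "(k, x - scale_fun k b)"]) auto
    qed
    show "?h ` (UNIV \<times> fn.span B) \<subseteq> fn.span (insert b B)"
      by (auto intro!: fn.span_add fn.span_scale intro: fn.span_base subsetD[OF fn.span_mono[of B]])
  qed
  moreover have "inj_on ?h (UNIV \<times> fn.span B)"
  proof (rule inj_onI, clarify)
    fix c c' v v' assume v: "v \<in> fn.span B" "v' \<in> fn.span B"
      and eq: "scale_fun c b + v = scale_fun c' b + v'"
    have "scale_fun (c - c') b = v' - v"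
      using eq by (simp add: fn.scale_left_diff_distrib algebra_simps)
    hence "scale_fun (c - c') b \<in> fn.span B" using v by (simp add: fn.span_diff)
    hence "scale_fun (inverse (c - c')) (scale_fun (c - c') b) \<in> fn.span B" by (rule fn.span_scale)
    hence "c = c'" using b by (cases "c = c'") auto
    thus "c = c' \<and> v = v'" using eq by simp
  qed
  ultimately show ?case using insert ind by (simp add: card_image card_cartesian_product)
qed simp

lemma card_subspace:
  fixes S :: "(nat \<Rightarrow> 'a::{field,finite}) set"
  assumes "fn.subspace S" "finite S"
  shows "card S = card (UNIV :: 'a set) ^ fn.dim S"
proof -
  obtain B where B: "B \<subseteq> S" "fn.independent B" "S \<subseteq> fn.span B" "card B = fn.dim S"
    using fn.basis_exists by metis
  have "fn.span B = S" using B assms(1) fn.span_minimal by blast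
  moreover have "finite B" using B(1) assms(2) finite_subset by blast
  ultimately show ?thesis using card_span_independent[of B] B by simp
qed

lemma card_UNIV_field_ge_2: "card (UNIV :: 'a::{field,finite} set) \<ge> 2"
  using card_mono[of "UNIV :: 'a set" "{0, 1}"] by simp

text \<open>Cardinality and dimension determine each other here, so the dimension arguments below
  are carried out by counting.\<close>

lemma dim_eq_iff_card:
  fixes S :: "(nat \<Rightarrow> 'a::{field,finite}) set"
  assumes "fn.subspace S" "finite S"
  shows "fn.dim S = m \<longleftrightarrow> card S = card (UNIV :: 'a set) ^ m"
  using card_UNIV_field_ge_2[where 'a = 'a] by (simp add: card_subspace[OF assms] power_inject_exp)

section \<open>Orthogonal complements by counting\<close>

definition dot :: "nat \<Rightarrow> (nat \<Rightarrow> 'a::field) \<Rightarrow> (nat \<Rightarrow> 'a) \<Rightarrow> 'a" where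
  "dot n c v = (\<Sum>i<n. c i * v i)"

definition perp :: "nat \<Rightarrow> (nat \<Rightarrow> 'a::field) set \<Rightarrow> (nat \<Rightarrow> 'a) set" where
  "perp n D = {v \<in> coord_space n. \<forall>c\<in>D. dot n c v = 0}"

lemma dot_commute: "dot n c v = dot n v c"
  by (simp add: dot_def mult.commute)

lemma dot_add: "dot n c (v + w) = dot n c v + dot n c w"
  by (simp add: dot_def distrib_left sum.distrib)

lemma dot_diff: "dot n c (v - w) = dot n c v - dot n c w"
  by (simp add: dot_def right_diff_distrib sum_subtractf)

lemma dot_scale: "dot n c (scale_fun a v) = a * dot n c v"
  by (simp add: dot_def scale_fun_apply sum_distrib_left ac_simps)

lemma dot_nonzero:
  assumes "c \<in> coord_space n" "c \<noteq> 0"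
  shows "\<exists>v\<in>coord_space n. dot n c v \<noteq> 0"
proof -
  obtain i where i: "c i \<noteq> 0" using assms(2) by (auto simp: fun_eq_iff)
  hence "i < n" using assms(1) by (metis (mono_tags) coord_space_def mem_Collect_eq not_le)
  moreover have "c j * (if j = i then 1 else 0) = (if j = i then c i else 0)" for j by simp
  ultimately have "dot n c (\<lambda>j. if j = i then 1 else 0) = c i"
    by (simp only: dot_def) simp
  moreover have "(\<lambda>j. if j = i then 1 else 0) \<in> coord_space n"
    using \<open>i < n\<close> by (auto simp: coord_space_def)
  ultimately show ?thesis using i by metis
qed

text \<open>Multiples of \<open>x\<close> attain every value of the functional, so all its fibres on
  \<open>S\<close> are translates of the kernel.\<close>

lemma card_dot_kernel:
  fixes S :: "(nat \<Rightarrow> 'a::{field,finite}) set"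
  assumes "fn.subspace S" "finite S" "x \<in> S" "dot n c x \<noteq> 0"
  shows "card {v \<in> S. dot n c v = 0} * card (UNIV :: 'a set) = card S"
proof -
  have eq: "card {v \<in> S. dot n c v = t} = card {v \<in> S. dot n c v = 0}" for t
  proof -
    let ?y = "scale_fun (t / dot n c x) x"
    have y: "?y \<in> S" using assms by (simp add: fn.subspace_scale)
    have dy: "dot n c ?y = t" using assms(4) by (simp only: dot_scale) simp
    have "bij_betw (\<lambda>v. v - ?y) {v \<in> S. dot n c v = t} {v \<in> S. dot n c v = 0}"
      by (rule bij_betw_byWitness[where f' = "\<lambda>v. v + ?y"])
         (use y dy assms(1) in \<open>auto simp: dot_add dot_diff fn.subspace_add fn.subspace_diff\<close>)
    thus ?thesis by (rule bij_betw_same_card)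
  qed
  have "card S = (\<Sum>t\<in>UNIV. card {v \<in> S. dot n c v = t})"
    by (rule card_eq_sum_fibers) (use assms in auto)
  also have "\<dots> = (\<Sum>t\<in>(UNIV :: 'a set). card {v \<in> S. dot n c v = 0})"
    by (rule sum.cong[OF refl eq])
  finally show ?thesis by (simp add: mult.commute)
qed

text \<open>Double counting of the orthogonal pairs in \<open>D \<times> F\<^sup>n\<close>.\<close>

lemma card_times_card_perp:
  fixes D :: "(nat \<Rightarrow> 'a::{field,finite}) set"
  assumes "fn.subspace D" "D \<subseteq> coord_space n"
  shows "card D * card (perp n D) = card (UNIV :: 'a set) ^ n"
proof -
  let ?Q = "card (UNIV :: 'a set)" and ?E = "coord_space n :: (nat \<Rightarrow> 'a) set"
  have fin: "finite D" "finite ?E" using assms(2) card_coord_space(1) finite_subset by blast+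
  have D0: "0 \<in> D" using assms(1) by (rule fn.subspace_0)
  define N where "N = card {p \<in> D \<times> ?E. dot n (fst p) (snd p) = 0}"
  have W: "perp n D \<subseteq> ?E" by (auto simp: perp_def)
  have "N = card (prod.swap ` {p \<in> ?E \<times> D. dot n (snd p) (fst p) = 0})"
    unfolding N_def by (rule arg_cong[where f = card]) (auto simp: image_iff)
  also have "\<dots> = card {p \<in> ?E \<times> D. dot n (snd p) (fst p) = 0}"
    by (rule card_image) (auto simp: inj_on_def)
  also have "\<dots> = (\<Sum>c\<in>D. card {v \<in> ?E. dot n c v = 0})"
    by (rule card_pairs_eq_sum[OF fin(2,1)])
  \<comment> \<open>Both counts carry a factor \<open>?Q\<close>, so that kernels have a simple size
    without the exponent \<open>n - 1\<close>. In this count \<open>c = 0\<close> is orthogonal to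
    everything and any other \<open>c\<close> to a hyperplane.\<close>
  finally have "N * ?Q = (\<Sum>c\<in>D. card {v \<in> ?E. dot n c v = 0} * ?Q)"
    by (simp add: sum_distrib_right)
  also have "\<dots> = (\<Sum>c\<in>D. if c = 0 then ?Q ^ n * ?Q else ?Q ^ n)"
  proof (rule sum.cong[OF refl])
    fix c assume c: "c \<in> D"
    show "card {v \<in> ?E. dot n c v = 0} * ?Q = (if c = 0 then ?Q ^ n * ?Q else ?Q ^ n)"
    proof (cases "c = 0")
      case True
      have "{v \<in> ?E. dot n c v = 0} = ?E" by (auto simp: True dot_def)
      thus ?thesis by (simp add: True card_coord_space)
    next
      case False
      then obtain v where "v \<in> ?E" "dot n c v \<noteq> 0" using dot_nonzero[of c n] c assms(2) by blast
      thus ?thesis using card_dot_kernel[OF subspace_coord_space fin(2)] False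
        by (simp add: card_coord_space)
    qed
  qed
  also have "\<dots> = ?Q ^ n * ?Q + (card D - 1) * ?Q ^ n"
    using fin D0 by (simp add: sum.remove[of D 0])
  finally have 1: "N * ?Q = ?Q ^ n * ?Q + (card D - 1) * ?Q ^ n" .
  \<comment> \<open>Second count: a vector of the complement is orthogonal to all of
    \<open>D\<close>, any other vector to a fraction \<open>1 / ?Q\<close> of it.\<close>
  have "N = (\<Sum>v\<in>?E. card {c \<in> D. dot n c v = 0})"
    unfolding N_def by (rule card_pairs_eq_sum[OF fin])
  hence "N * ?Q = (\<Sum>v\<in>?E. card {c \<in> D. dot n c v = 0} * ?Q)"
    by (simp add: sum_distrib_right)
  also have "\<dots> = (\<Sum>v\<in>?E. if v \<in> perp n D then card D * ?Q else card D)"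
  proof (rule sum.cong[OF refl])
    fix v assume v: "v \<in> ?E"
    show "card {c \<in> D. dot n c v = 0} * ?Q = (if v \<in> perp n D then card D * ?Q else card D)"
    proof (cases "v \<in> perp n D")
      case True
      hence "{c \<in> D. dot n c v = 0} = D" by (auto simp: perp_def)
      thus ?thesis using True by simp
    next
      case False
      then obtain c where "c \<in> D" "dot n c v \<noteq> 0" using v by (auto simp: perp_def)
      thus ?thesis using card_dot_kernel[OF assms(1) fin(1), of c n v] False
        by (simp add: dot_commute[of n v])
    qed
  qed
  also have "\<dots> = card (perp n D) * (card D * ?Q) + (?Q ^ n - card (perp n D)) * card D"
    using W fin(2) by (simp add: sum.If_cases Int_absorb1 card_Diff_subset finite_subset
        card_coord_space Diff_eq[symmetric])
  finally have 2: "N * ?Q = card (perp n D) * (card D * ?Q) + (?Q ^ n - card (perp n D)) * card D" .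
  have le: "card (perp n D) \<le> ?Q ^ n" "1 \<le> card D"
    using card_mono[OF fin(2) W] D0 fin(1) by (auto simp: card_coord_space Suc_le_eq card_gt_0_iff)
  \<comment> \<open>The substitutions remove the truncated differences from the two counts; then the
    factor \<open>?Q - 1 = Suc l\<close> cancels.\<close>
  obtain m where m: "?Q ^ n = card (perp n D) + m" using le by (metis le_iff_add)
  obtain k where k: "card D = Suc k" using le by (cases "card D") auto
  obtain l where l: "?Q = Suc (Suc l)"
    using card_UNIV_field_ge_2[where 'a = 'a] by (metis add_2_eq_Suc le_Suc_ex)
  have "(card (perp n D) + m) * ?Q + k * (card (perp n D) + m)
      = card (perp n D) * (Suc k * ?Q) + m * Suc k"
    using 1 2 by (simp add: m k)
  hence "Suc l * (card (perp n D) + m) = Suc l * (Suc k * card (perp n D))"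
    unfolding l by (simp add: algebra_simps)
  hence "card (perp n D) + m = Suc k * card (perp n D)" by (simp only: mult_cancel1) simp
  thus ?thesis by (simp only: m k)
qed

section \<open>Projective points, codewords and common zeros\<close>

lemma span_scale_singleton:
  assumes "c \<noteq> 0"
  shows "fn.span {scale_fun c v} = fn.span {v}"
proof
  show "fn.span {scale_fun c v} \<subseteq> fn.span {v}"
    by (rule fn.span_minimal) (auto intro: fn.span_scale fn.span_base)
  have "v = scale_fun (1 / c) (scale_fun c v)" using assms by (simp add: fun_eq_iff scale_fun_apply)
  hence "v \<in> fn.span {scale_fun c v}" by (metis fn.span_scale fn.span_base singletonI)
  thus "fn.span {v} \<subseteq> fn.span {scale_fun c v}" by (intro fn.span_minimal) auto
qed

lemma dim_singleton: "v \<noteq> 0 \<Longrightarrow> fn.dim {v} = 1"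
  using fn.dim_eq_card_independent[of "{v}"] by simp

lemma span_singleton_in_PG_iff:
  assumes "v \<noteq> 0"
  shows "fn.span {v} \<in> PG r \<longleftrightarrow> v \<in> coord_space (Suc r)"
proof
  assume "fn.span {v} \<in> PG r"
  thus "v \<in> coord_space (Suc r)" by (auto simp: PG_def intro: fn.span_base)
next
  assume "v \<in> coord_space (Suc r)"
  hence "fn.span {v} \<subseteq> coord_space (Suc r)"
    by (intro fn.span_minimal subspace_coord_space) auto
  thus "fn.span {v} \<in> PG r" by (simp add: PG_def dim_singleton assms)
qed

lemma span_singleton_in_hypersurface_iff:
  assumes "v \<noteq> 0"
  shows "fn.span {v} \<in> hypersurface r p \<longleftrightarrow>
    v \<in> coord_space (Suc r) \<and> eval_mvpoly (homogenize p) v = 0"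
proof -
  have "eval_mvpoly (homogenize p) w = 0"
    if w: "w \<in> fn.span {v}" and v: "eval_mvpoly (homogenize p) v = 0" for w
  proof -
    obtain c where "w = (\<lambda>i. c * v i)" using w by (auto simp: fn.span_singleton scale_fun_def)
    thus ?thesis using v by (simp add: eval_homogenize_scale)
  qed
  thus ?thesis using assms
    by (auto simp: hypersurface_def span_singleton_in_PG_iff intro: fn.span_base)
qed

text \<open>Each point of \<Omega> is represented by exactly one column, and its line has
  \<open>card UNIV - 1\<close> nonzero vectors. Invariance of \<open>U\<close> under nonzero scalars
  makes membership independent of the representative, so positions can be counted through
  vectors.\<close>

lemma card_columns:
  fixes G :: "nat \<Rightarrow> nat \<Rightarrow> 'a::{field,finite}"
  assumes G: "point_matrix r \<Omega> G" and \<Omega>: "\<Omega> \<subseteq> PG r"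
    and U: "\<And>c v. c \<noteq> 0 \<Longrightarrow> scale_fun c v \<in> U \<longleftrightarrow> v \<in> U"
  shows "card {j. j < card \<Omega> \<and> (\<lambda>i. G i j) \<in> U} * (card (UNIV :: 'a set) - 1)
    = card {v \<in> U. v \<noteq> 0 \<and> fn.span {v} \<in> \<Omega>}"
proof -
  let ?g = "\<lambda>j i. G i j"
  let ?J = "{j. j < card \<Omega> \<and> ?g j \<in> U}"
  let ?h = "\<lambda>(j, c). scale_fun c (?g j)"
  have bij: "bij_betw (\<lambda>j. fn.span {?g j}) {..<card \<Omega>} \<Omega>"
    using G by (simp add: point_matrix_def)
  have mem: "fn.span {?g j} \<in> \<Omega>" if "j < card \<Omega>" for j
    using bij that by (auto simp: bij_betw_def)
  \<comment> \<open>A zero column would span a space of dimension 0, which is not a projective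
    point.\<close>
  have nz: "?g j \<noteq> 0" if "j < card \<Omega>" for j
  proof
    assume "?g j = 0"
    hence "fn.dim (fn.span {?g j}) = 0"
      using fn.dim_eq_card_independent[OF fn.independent_empty]
      by (metis fn.dim_span fn.span_insert_0 card.empty)
    thus False using mem[OF that] \<Omega> by (auto simp: PG_def)
  qed
  have inj: "inj_on ?h (?J \<times> (UNIV - {0}))"
  proof (rule inj_onI)
    fix x y assume x: "x \<in> ?J \<times> (UNIV - {0})" and y: "y \<in> ?J \<times> (UNIV - {0})" and h: "?h x = ?h y"
    obtain j c j' c' where xy: "x = (j, c)" "y = (j', c')" by (cases x, cases y)
    have j: "j < card \<Omega>" "j' < card \<Omega>" and c: "c \<noteq> 0" "c' \<noteq> 0"
      and eq: "scale_fun c (?g j) = scale_fun c' (?g j')"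
      using x y h by (auto simp: xy)
    have "fn.span {?g j} = fn.span {?g j'}"
      using arg_cong[OF eq, of "\<lambda>v. fn.span {v}"]
      by (simp only: span_scale_singleton[OF c(1)] span_scale_singleton[OF c(2)])
    hence "j = j'" using bij j by (auto simp: bij_betw_def inj_on_def)
    moreover from this have "c = c'" using eq nz[OF j(1)] by (auto simp: fun_eq_iff scale_fun_apply)
    ultimately show "x = y" by (simp add: xy)
  qed
  have "?h ` (?J \<times> (UNIV - {0})) = {v \<in> U. v \<noteq> 0 \<and> fn.span {v} \<in> \<Omega>}"
  proof
    show "?h ` (?J \<times> (UNIV - {0})) \<subseteq> {v \<in> U. v \<noteq> 0 \<and> fn.span {v} \<in> \<Omega>}"
    proof
      fix x assume "x \<in> ?h ` (?J \<times> (UNIV - {0}))"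
      then obtain j c where j: "j < card \<Omega>" "?g j \<in> U" and c: "c \<noteq> 0" and x: "x = scale_fun c (?g j)"
        by auto
      show "x \<in> {v \<in> U. v \<noteq> 0 \<and> fn.span {v} \<in> \<Omega>}"
        unfolding x using j U[OF c] nz[OF j(1)] mem[OF j(1)] c
        by (simp only: mem_Collect_eq span_scale_singleton[OF c] fn.scale_eq_0_iff) simp
    qed
    show "{v \<in> U. v \<noteq> 0 \<and> fn.span {v} \<in> \<Omega>} \<subseteq> ?h ` (?J \<times> (UNIV - {0}))"
    proof clarify
      fix v assume v: "v \<in> U" "v \<noteq> 0" "fn.span {v} \<in> \<Omega>"
      then obtain j where j: "j < card \<Omega>" "fn.span {?g j} = fn.span {v}"
        using bij unfolding bij_betw_def by (metis (no_types, lifting) imageE lessThan_iff)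
      have "v \<in> fn.span {?g j}" using j(2) by (simp add: fn.span_base)
      then obtain c where c: "v = scale_fun c (?g j)" unfolding fn.span_singleton by blast
      moreover have "c \<noteq> 0" using c v(2) by auto
      ultimately show "v \<in> ?h ` (?J \<times> (UNIV - {0}))"
        using v(1) j(1) U by (intro image_eqI[of _ _ "(j, c)"]) auto
    qed
  qed
  hence "card {v \<in> U. v \<noteq> 0 \<and> fn.span {v} \<in> \<Omega>} = card (?J \<times> (UNIV - {0 :: 'a}))"
    using card_image[OF inj] by simp
  thus ?thesis by (simp add: card_cartesian_product card_Diff_singleton)
qed

text \<open>The codeword of the linear form with coefficients \<open>c\<close>: its zeros are the
  columns lying in the hyperplane \<open>c\<close>.\<close>

definition encode :: "nat \<Rightarrow> (nat \<Rightarrow> nat \<Rightarrow> 'a::field) \<Rightarrow> (nat \<Rightarrow> 'a) \<Rightarrow> nat \<Rightarrow> 'a" where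
  "encode r G c = (\<lambda>j. dot (Suc r) c (\<lambda>i. G i j))"

lemma encode_add: "encode r G (c + d) = encode r G c + encode r G d"
  by (simp add: encode_def fun_eq_iff dot_def distrib_right sum.distrib)

lemma encode_scale: "encode r G (scale_fun a c) = scale_fun a (encode r G c)"
  by (simp add: encode_def fun_eq_iff dot_def scale_fun_apply sum_distrib_left distrib_left mult.assoc)

lemma encode_0: "encode r G 0 = 0"
  by (simp add: encode_def dot_def fun_eq_iff)

lemma subspace_encode_image: "fn.subspace U \<Longrightarrow> fn.subspace (encode r G ` U)"
proof (rule fn.subspaceI)
  assume U: "fn.subspace U"
  show "0 \<in> encode r G ` U" using fn.subspace_0[OF U] encode_0[of r G] by (metis image_eqI)
  show "x + y \<in> encode r G ` U" if "x \<in> encode r G ` U" "y \<in> encode r G ` U" for x y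
    using that fn.subspace_add[OF U] by (auto simp flip: encode_add)
  show "scale_fun c x \<in> encode r G ` U" if "x \<in> encode r G ` U" for c x
    using that fn.subspace_scale[OF U] by (auto simp flip: encode_scale)
qed

lemma subspace_encode_vimage:
  assumes "fn.subspace D"
  shows "fn.subspace {c \<in> coord_space n. encode r G c \<in> D}"
proof -
  note E = subspace_coord_space[of n]
  show ?thesis
    by (rule fn.subspaceI)
       (auto simp: encode_add encode_scale encode_0 intro: fn.subspace_0[OF assms] fn.subspace_0[OF E]
         fn.subspace_add[OF assms] fn.subspace_add[OF E] fn.subspace_scale[OF assms] fn.subspace_scale[OF E])
qed

lemma row_code_eq_encode: "row_code r G = encode r G ` coord_space (Suc r)"
proof
  have "G i \<in> encode r G ` coord_space (Suc r)" if "i \<le> r" for i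
  proof (rule image_eqI)
    let ?u = "\<lambda>k. if k = i then 1 else 0"
    have "?u k * G k j = (if k = i then G i j else 0)" for k j by simp
    thus "G i = encode r G ?u" using that by (simp only: encode_def dot_def fun_eq_iff) simp
    show "?u \<in> coord_space (Suc r)" using that by (auto simp: coord_space_def)
  qed
  thus "row_code r G \<subseteq> encode r G ` coord_space (Suc r)"
    unfolding row_code_def
    by (intro fn.span_minimal subspace_encode_image subspace_coord_space) auto
  show "encode r G ` coord_space (Suc r) \<subseteq> row_code r G"
  proof clarify
    fix c :: "nat \<Rightarrow> 'a"
    have "(\<Sum>i\<in>A. scale_fun (c i) (G i)) j = (\<Sum>i\<in>A. c i * G i j)" for A :: "nat set" and j
      by (induction A rule: infinite_finite_induct) (auto simp: scale_fun_apply)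
    hence "encode r G c = (\<Sum>i<Suc r. scale_fun (c i) (G i))"
      by (simp only: encode_def dot_def fun_eq_iff) simp
    also have "\<dots> \<in> row_code r G"
      unfolding row_code_def by (intro fn.span_sum fn.span_scale fn.span_base) auto
    finally show "encode r G c \<in> row_code r G" .
  qed
qed

text \<open>Two distinct words differ exactly on the support of the line spanned by their
  difference, and every line in \<open>C\<close> arises so, by pairing a spanning word with
  0.\<close>

lemma min_distance_eq_gen_hamming_weight_1:
  assumes "fn.subspace C"
  shows "min_distance C = gen_hamming_weight 1 C"
proof -
  have supp: "code_support (fn.span {d}) = {i. d i \<noteq> 0}" for d :: "nat \<Rightarrow> 'a"
    by (auto simp: code_support_def fn.span_singleton scale_fun_apply intro!: exI[of _ "1 :: 'a"])
  have "{card {i. c i \<noteq> c' i} | c c'. c \<in> C \<and> c' \<in> C \<and> c \<noteq> c'}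
      = {card (code_support D) | D. fn.subspace D \<and> D \<subseteq> C \<and> fn.dim D = 1}" (is "?A = ?B")
  proof
    show "?A \<subseteq> ?B"
    proof clarify
      fix c c' assume c: "c \<in> C" "c' \<in> C" "c \<noteq> c'"
      have "{i. c i \<noteq> c' i} = code_support (fn.span {c - c'})" by (simp add: supp)
      moreover have "fn.span {c - c'} \<subseteq> C"
        using c assms by (intro fn.span_minimal) (auto intro: fn.subspace_diff)
      moreover have "fn.dim (fn.span {c - c'}) = 1" using c dim_singleton[of "c - c'"] by simp
      ultimately show "\<exists>D. card {i. c i \<noteq> c' i} = card (code_support D) \<and> fn.subspace D \<and> D \<subseteq> C \<and> fn.dim D = 1"
        using fn.subspace_span by metis
    qed
    show "?B \<subseteq> ?A"
    proof clarify
      fix D assume D: "fn.subspace D" "D \<subseteq> C" "fn.dim D = 1"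
      obtain B where B: "B \<subseteq> D" "fn.independent B" "D \<subseteq> fn.span B" "card B = 1"
        using fn.basis_exists D(3) by metis
      then obtain d where d: "B = {d}" by (metis card_1_singletonE)
      have "D = fn.span {d}" using B D(1) d fn.span_minimal by blast
      hence "code_support D = {i. d i \<noteq> (0 :: nat \<Rightarrow> 'a) i}" by (simp add: supp)
      moreover have "d \<in> C" using B(1) D(2) d by blast
      moreover have "d \<noteq> 0" using B(2) d fn.dependent_zero by blast
      ultimately show "\<exists>c c'. card (code_support D) = card {i. c i \<noteq> c' i} \<and> c \<in> C \<and> c' \<in> C \<and> c \<noteq> c'"
        by (intro exI[of _ d] exI[of _ 0] conjI fn.subspace_0[OF assms]) simp_all
    qed
  qed
  thus ?thesis by (simp add: min_distance_def gen_hamming_weight_def)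
qed

text \<open>Support and common zeros of a subcode partition the positions, so minimal support means
  the maximal number \<open>z\<close> of common zeros. Integers keep the difference from being
  truncated.\<close>

lemma gen_hamming_weight_eqI:
  assumes C: "C \<subseteq> coord_space N"
    and ex: "fn.subspace D0" "D0 \<subseteq> C" "fn.dim D0 = m" "card {j. j < N \<and> (\<forall>c\<in>D0. c j = 0)} = z"
    and le: "\<And>D. fn.subspace D \<Longrightarrow> D \<subseteq> C \<Longrightarrow> fn.dim D = m \<Longrightarrow>
      card {j. j < N \<and> (\<forall>c\<in>D. c j = 0)} \<le> z"
  shows "int (gen_hamming_weight m C) = int N - int z"
proof -
  have supp: "card (code_support D) + card {j. j < N \<and> (\<forall>c\<in>D. c j = 0)} = N" if "D \<subseteq> C" for D
  proof -
    have "c j = 0" if "c \<in> D" "N \<le> j" for c j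
      using C that \<open>D \<subseteq> C\<close> by (auto simp: coord_space_def)
    hence eq: "code_support D = {..<N} - {j. j < N \<and> (\<forall>c\<in>D. c j = 0)}"
      by (auto simp: code_support_def not_le[symmetric])
    have "card {j. j < N \<and> (\<forall>c\<in>D. c j = 0)} \<le> card {..<N}" by (intro card_mono) auto
    thus "card (code_support D) + card {j. j < N \<and> (\<forall>c\<in>D. c j = 0)} = N"
      unfolding eq by (subst card_Diff_subset) auto
  qed
  let ?S = "{card (code_support D) | D. fn.subspace D \<and> D \<subseteq> C \<and> fn.dim D = m}"
  have "gen_hamming_weight m C = N - z" unfolding gen_hamming_weight_def
  proof (rule Min_eqI)
    have "card (code_support D) \<le> N" if "D \<subseteq> C" for D using supp[OF that] by linarith
    hence "?S \<subseteq> {..N}" by blast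
    thus "finite ?S" using finite_subset by blast
    fix y assume "y \<in> ?S"
    then obtain D where D: "y = card (code_support D)" "fn.subspace D" "D \<subseteq> C" "fn.dim D = m" by blast
    show "N - z \<le> y" using le[OF D(2-4)] supp[OF D(3)] D(1) by linarith
  next
    have "N - z = card (code_support D0)" using supp[OF ex(2)] ex(4) by linarith
    thus "N - z \<in> ?S" using ex(1-3) by blast
  qed
  moreover have "z \<le> N" using supp[OF ex(2)] ex(4) by simp
  ultimately show ?thesis by simp
qed

section \<open>Plane sections of the variety\<close>

text \<open>All words encoded from \<open>D\<close> vanish at a position exactly when its column is
  orthogonal to \<open>D\<close>; \<open>card_columns\<close> then applies to this orthogonal
  space.\<close>

lemma card_zero_positions:
  fixes G :: "nat \<Rightarrow> nat \<Rightarrow> 'a::{field,finite}"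
  assumes G: "point_matrix r \<Omega> G" and \<Omega>: "\<Omega> \<subseteq> PG r"
  shows "card {j. j < card \<Omega> \<and> (\<forall>c\<in>encode r G ` D. c j = 0)} * (card (UNIV :: 'a set) - 1)
    = card {v \<in> perp (Suc r) D. v \<noteq> 0 \<and> fn.span {v} \<in> \<Omega>}"
proof -
  have "(\<lambda>i. G i j) \<in> coord_space (Suc r)" for j
    using G by (auto simp: point_matrix_def coord_space_def)
  hence "{j. j < card \<Omega> \<and> (\<forall>c\<in>encode r G ` D. c j = 0)}
      = {j. j < card \<Omega> \<and> (\<lambda>i. G i j) \<in> perp (Suc r) D}"
    by (auto simp: perp_def encode_def)
  moreover have "scale_fun c v \<in> perp (Suc r) D \<longleftrightarrow> v \<in> perp (Suc r) D" if "c \<noteq> 0" for c v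
    using that by (auto simp: perp_def coord_space_def dot_scale scale_fun_apply)
  ultimately show ?thesis using card_columns[OF G \<Omega>] by simp
qed

definition vec4 :: "'a::field \<Rightarrow> 'a \<Rightarrow> 'a \<Rightarrow> 'a \<Rightarrow> nat \<Rightarrow> 'a" where
  "vec4 x y z w = (\<lambda>i. if i = 0 then x else if i = 1 then y else if i = 2 then z else if i = 3 then w else 0)"

lemma vec4_nth [simp]:
  "vec4 x y z w 0 = x" "vec4 x y z w (Suc 0) = y" "vec4 x y z w 1 = y" "vec4 x y z w 2 = z" "vec4 x y z w 3 = w"
  by (simp_all add: vec4_def)

lemma vec4_in_coord_space: "vec4 x y z w \<in> coord_space 4"
  by (auto simp: vec4_def coord_space_def)

lemma vec4_eq_iff: "vec4 x y z w = vec4 x' y' z' w' \<longleftrightarrow> x = x' \<and> y = y' \<and> z = z' \<and> w = w'"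
  by (metis vec4_nth(1,3-5))

lemma vec4_0: "vec4 0 0 0 0 = 0"
  by (auto simp: vec4_def fun_eq_iff)

lemma vec4_eq_0_iff: "vec4 x y z w = 0 \<longleftrightarrow> x = 0 \<and> y = 0 \<and> z = 0 \<and> w = 0"
  using vec4_eq_iff[of x y z w 0 0 0 0] by (simp only: vec4_0)

lemma vec4_expand:
  assumes "v \<in> coord_space 4"
  shows "v = vec4 (v 0) (v 1) (v 2) (v 3)"
proof
  fix i :: nat
  have "i = 0 \<or> i = 1 \<or> i = 2 \<or> i = 3 \<or> 4 \<le> i" by linarith
  thus "v i = vec4 (v 0) (v 1) (v 2) (v 3) i" using assms by (auto simp: vec4_def coord_space_def)
qed

lemma vec4_add: "vec4 x y z w + vec4 x' y' z' w' = vec4 (x + x') (y + y') (z + z') (w + w')"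
  by (auto simp: vec4_def fun_eq_iff)

lemma vec4_scale: "scale_fun c (vec4 x y z w) = vec4 (c * x) (c * y) (c * z) (c * w)"
  by (auto simp: vec4_def fun_eq_iff scale_fun_apply)

lemma dot_4: "dot 4 c v = c 0 * v 0 + c 1 * v 1 + c 2 * v 2 + c 3 * v 3"
  by (simp add: dot_def eval_nat_numeral)

context suzuki_tits
begin

text \<open>The vectors of the cone over the variety that lie in the plane with coefficient vector \<open>c\<close>
  come from affine points, each contributing \<open>q\<^sup>2 - 1\<close> multiples, and from vectors at infinity.\<close>

definition plane_cone :: "(nat \<Rightarrow> 'a) \<Rightarrow> (nat \<Rightarrow> 'a) set" where
  "plane_cone c = {v \<in> coord_space 4. v \<noteq> 0 \<and> cone_eq v \<and> dot 4 c v = 0}"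

definition plane_aff :: "(nat \<Rightarrow> 'a) \<Rightarrow> (('a \<times> 'a) \<times> 'a) set" where
  "plane_aff c = {p. tr (snd p) = \<Gamma> (fst (fst p)) + \<Gamma> (snd (fst p)) \<and>
     c 0 + c 1 * fst (fst p) + c 2 * snd (fst p) + c 3 * snd p = 0}"

definition plane_inf :: "(nat \<Rightarrow> 'a) \<Rightarrow> (('a \<times> 'a) \<times> 'a) set" where
  "plane_inf c = {p. p \<noteq> ((0, 0), 0) \<and> fst (fst p) ^ (s + 2) = snd (fst p) ^ (s + 2) \<and>
     c 1 * fst (fst p) + c 2 * snd (fst p) + c 3 * snd p = 0}"

lemma card_plane_cone: "card (plane_cone c) = (q\<^sup>2 - 1) * card (plane_aff c) + card (plane_inf c)"
proof -
  define h where "h = (\<lambda>(l :: 'a, ((x, y), z)). vec4 l (l * x) (l * y) (l * z))"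
  define g where "g = (\<lambda>((x, y), z). vec4 (0 :: 'a) x y z)"
  have aff: "cone_eq (vec4 l (l * x) (l * y) (l * z)) \<longleftrightarrow> tr z = \<Gamma> x + \<Gamma> y" if "l \<noteq> 0" for l x y z
    using cone_eq_affine[of "vec4 l (l * x) (l * y) (l * z)"] that by simp
  have aff_dot: "dot 4 c (vec4 l (l * x) (l * y) (l * z)) = 0 \<longleftrightarrow> c 0 + c 1 * x + c 2 * y + c 3 * z = 0"
    if "l \<noteq> 0" for l x y z
  proof -
    have "dot 4 c (vec4 l (l * x) (l * y) (l * z)) = l * (c 0 + c 1 * x + c 2 * y + c 3 * z)"
      unfolding dot_4 vec4_nth by (simp only: distrib_left ac_simps)
    thus ?thesis using that by (simp only: mult_eq_0_iff simp_thms)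
  qed
  have inf: "cone_eq (vec4 0 x y z) \<longleftrightarrow> x ^ (s + 2) = y ^ (s + 2)" for x y z
    using cone_eq_infinity[of "vec4 0 x y z"] by (simp only: vec4_nth simp_thms)
  have "plane_cone c = h ` ((UNIV - {0}) \<times> plane_aff c) \<union> g ` plane_inf c"
  proof (intro equalityI subsetI)
    fix v assume v: "v \<in> plane_cone c"
    hence v4: "v = vec4 (v 0) (v 1) (v 2) (v 3)" by (intro vec4_expand) (simp add: plane_cone_def)
    show "v \<in> h ` ((UNIV - {0}) \<times> plane_aff c) \<union> g ` plane_inf c"
    proof (cases "v 0 = 0")
      case True
      hence v4': "v = vec4 0 (v 1) (v 2) (v 3)" using v4 by simp
      have "((v 1, v 2), v 3) \<in> plane_inf c"
        using v inf[of "v 1" "v 2" "v 3"] True v4'[symmetric] vec4_0 v4'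
        by (auto simp: plane_cone_def plane_inf_def dot_4 simp del: power_Suc)
      hence "v \<in> g ` plane_inf c" using v4' by (intro image_eqI[of _ _ "((v 1, v 2), v 3)"]) (auto simp: g_def)
      thus ?thesis by blast
    next
      case False
      let ?x = "v 1 / v 0" and ?y = "v 2 / v 0" and ?z = "v 3 / v 0"
      have v4': "v = vec4 (v 0) (v 0 * ?x) (v 0 * ?y) (v 0 * ?z)"
        using v4 False by simp
      have "cone_eq v" "dot 4 c v = 0" using v by (simp_all add: plane_cone_def)
      hence "((?x, ?y), ?z) \<in> plane_aff c"
        using aff[OF False, of ?x ?y ?z] aff_dot[OF False, of ?x ?y ?z] unfolding v4'[symmetric]
        by (simp add: plane_aff_def)
      hence "v \<in> h ` ((UNIV - {0}) \<times> plane_aff c)"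
        using v4' False by (intro image_eqI[of _ _ "(v 0, ((?x, ?y), ?z))"]) (auto simp: h_def)
      thus ?thesis by blast
    qed
  next
    fix v assume "v \<in> h ` ((UNIV - {0}) \<times> plane_aff c) \<union> g ` plane_inf c"
    thus "v \<in> plane_cone c"
    proof
      assume "v \<in> h ` ((UNIV - {0}) \<times> plane_aff c)"
      then obtain l x y z where l: "l \<noteq> 0" and p: "((x, y), z) \<in> plane_aff c"
        and v: "v = vec4 l (l * x) (l * y) (l * z)" by (auto simp: h_def)
      show ?thesis
        using p l aff[OF l, of x y z] aff_dot[OF l, of x y z]
        by (simp add: v plane_cone_def plane_aff_def vec4_in_coord_space vec4_eq_0_iff)
    next
      assume "v \<in> g ` plane_inf c"
      then obtain x y z where p: "((x, y), z) \<in> plane_inf c" and v: "v = vec4 0 x y z"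
        by (auto simp: g_def)
      show ?thesis
        using p inf[of x y z]
        by (auto simp: v plane_cone_def plane_inf_def vec4_in_coord_space vec4_eq_0_iff dot_4 simp del: power_Suc)
    qed
  qed
  moreover have "inj_on h ((UNIV - {0}) \<times> plane_aff c)" "inj_on g (plane_inf c)"
    by (auto simp: inj_on_def h_def g_def vec4_eq_iff)
  moreover have "h ` ((UNIV - {0}) \<times> plane_aff c) \<inter> g ` plane_inf c = {}"
    by (auto simp: h_def g_def vec4_eq_iff)
  ultimately show ?thesis
    by (simp add: card_Un_disjoint card_image card_cartesian_product card_Diff_singleton card_UNIV)
qed

text \<open>The plane misses \<open>(0, 0, 0, 1)\<close>, so projection from that point is injective
  on it.\<close>

lemma card_plane_aff_c3:
  assumes "c 3 \<noteq> 0"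
  shows "card (plane_aff c) \<le> q ^ 3 + q\<^sup>2 - q"
proof -
  let ?S = "{p. tr (c 0 / c 3 + c 1 / c 3 * fst p + c 2 / c 3 * snd p) = \<Gamma> (fst p) + \<Gamma> (snd p)}"
  have z: "z = c 0 / c 3 + c 1 / c 3 * x + c 2 / c 3 * y" if "c 0 + c 1 * x + c 2 * y + c 3 * z = 0" for x y z
  proof -
    have "c 3 * z = c 0 + c 1 * x + c 2 * y" using that by (simp only: add_eq_0_iff_char_2)
    hence "z = (c 0 + c 1 * x + c 2 * y) / c 3" using assms by (simp add: eq_divide_eq mult.commute)
    thus ?thesis by (simp add: add_divide_distrib)
  qed
  have "inj_on fst (plane_aff c)"
  proof (rule inj_onI)
    fix p p' assume "p \<in> plane_aff c" "p' \<in> plane_aff c" "fst p = fst p'"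
    thus "p = p'" using z[of "fst (fst p)" "snd (fst p)" "snd p"] z[of "fst (fst p')" "snd (fst p')" "snd p'"]
      unfolding plane_aff_def mem_Collect_eq by (simp only: prod_eq_iff simp_thms)
  qed
  moreover have "fst ` plane_aff c \<subseteq> ?S"
  proof
    fix x assume "x \<in> fst ` plane_aff c"
    then obtain p where p: "p \<in> plane_aff c" "x = fst p" by blast
    show "x \<in> ?S" using p(1) z[of "fst (fst p)" "snd (fst p)" "snd p"]
      unfolding plane_aff_def mem_Collect_eq p(2) by (simp only: simp_thms)
  qed
  ultimately have "card (plane_aff c) \<le> card ?S" by (intro card_inj_on_le) auto
  thus ?thesis using card_affine_plane_section_le by (rule order.trans)
qed

text \<open>The line at infinity of such a plane misses the vertex of the three concurrent lines. So
  \<open>y\<close> is nonzero, \<open>x / y\<close> is one of at most three roots of unity, and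
  \<open>z\<close> is determined by \<open>x\<close> and \<open>y\<close>.\<close>

lemma card_plane_inf_c3:
  assumes "c 3 \<noteq> 0"
  shows "card (plane_inf c) \<le> 3 * (q\<^sup>2 - 1)"
proof -
  let ?M = "{u :: 'a. u ^ (s + 2) = 1}"
  let ?h = "\<lambda>p :: ('a \<times> 'a) \<times> 'a. (fst (fst p) / snd (fst p), snd (fst p))"
  have z: "z = (c 1 * x + c 2 * y) / c 3" if "c 1 * x + c 2 * y + c 3 * z = 0" for x y z
  proof -
    have "c 3 * z = c 1 * x + c 2 * y" using that by (simp only: add_eq_0_iff_char_2)
    thus ?thesis using assms by (simp add: eq_divide_eq mult.commute)
  qed
  have y0: "y \<noteq> 0" if "((x, y), z) \<in> plane_inf c" for x y z
  proof
    assume y: "y = 0"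
    have "x = 0" using that y by (auto simp: plane_inf_def)
    moreover have "z = 0" using that y \<open>x = 0\<close> assms by (auto simp: plane_inf_def)
    ultimately show False using that y by (simp add: plane_inf_def)
  qed
  have "inj_on ?h (plane_inf c)"
  proof (rule inj_onI)
    fix p p' assume p: "p \<in> plane_inf c" "p' \<in> plane_inf c" and h: "?h p = ?h p'"
    obtain x y z x' y' z' where xyz: "p = ((x, y), z)" "p' = ((x', y'), z')" by (metis surj_pair)
    have y: "y = y'" and "x / y = x' / y'" using h unfolding xyz fst_conv snd_conv prod.inject by blast+
    hence xy: "x = x'" "y = y'" using y0[of x y z] p(1) by (simp_all add: xyz)
    have "z = (c 1 * x + c 2 * y) / c 3" "z' = (c 1 * x' + c 2 * y') / c 3"
      using p z by (simp_all only: plane_inf_def mem_Collect_eq xyz fst_conv snd_conv)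
    thus "p = p'" by (simp only: xyz xy)
  qed
  moreover have "?h ` plane_inf c \<subseteq> ?M \<times> (UNIV - {0})"
  proof
    fix w assume "w \<in> ?h ` plane_inf c"
    then obtain x y z where p: "((x, y), z) \<in> plane_inf c" "w = (x / y, y)" by auto
    have "x ^ (s + 2) = y ^ (s + 2)" using p(1) by (simp add: plane_inf_def)
    hence "(x / y) ^ (s + 2) = 1" using y0[OF p(1)] by (simp only: power_divide) simp
    thus "w \<in> ?M \<times> (UNIV - {0})" using y0[OF p(1)] p(2) by simp
  qed
  ultimately have "card (plane_inf c) \<le> card (?M \<times> (UNIV - {0 :: 'a}))" by (intro card_inj_on_le) auto
  also have "\<dots> = card ?M * (q\<^sup>2 - 1)" by (simp add: card_cartesian_product card_Diff_singleton card_UNIV)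
  also have "\<dots> \<le> 3 * (q\<^sup>2 - 1)" by (intro mult_right_mono card_roots_of_unity_le_3) simp
  finally show ?thesis .
qed

text \<open>The plane is a cylinder over an affine line with \<open>q^2\<close> points, each having
  \<open>q\<close> points of the variety above it.\<close>

lemma card_plane_aff_vertical:
  assumes "c 3 = 0" "c 1 \<noteq> 0 \<or> c 2 \<noteq> 0"
  shows "card (plane_aff c) = q ^ 3"
proof -
  have "plane_aff c = {p. fst p \<in> {p. c 0 + c 1 * fst p + c 2 * snd p = 0}
      \<and> tr (snd p) = \<Gamma> (fst (fst p)) + \<Gamma> (snd (fst p))}"
    by (auto simp: plane_aff_def assms(1) simp del: add_eq_0_iff_char_2)
  thus ?thesis
    by (simp only: card_\<Gamma>_cylinder card_line_in_plane[OF assms(2)] card_UNIV)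
       (simp add: power2_eq_square power3_eq_cube)
qed

text \<open>These are the nonzero vectors on a projective line with \<open>q^2 + 1\<close>
  points.\<close>

lemma card_infinite_line:
  assumes "c1 \<noteq> 0 \<or> c2 \<noteq> 0"
  shows "card ({p :: 'a \<times> 'a. c1 * fst p + c2 * snd p = 0} \<times> (UNIV :: 'a set) - {((0, 0), 0)})
    = (q\<^sup>2 - 1) * (q\<^sup>2 + 1)"
proof -
  let ?L = "{p :: 'a \<times> 'a. c1 * fst p + c2 * snd p = 0}"
  have "card ?L = q\<^sup>2"
    using card_line_in_plane[OF assms, of 0] by (simp only: add_0_left card_UNIV)
  hence "card (?L \<times> (UNIV :: 'a set) - {((0, 0), 0)}) = q\<^sup>2 * q\<^sup>2 - 1"
    by (subst card_Diff_singleton) (simp_all add: card_cartesian_product card_UNIV del: add_eq_0_iff_char_2)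
  also have "\<dots> = (q\<^sup>2 - 1) * (q\<^sup>2 + 1)" by (simp add: algebra_simps)
  finally show ?thesis .
qed

lemma card_plane_inf_vertical:
  assumes "c 3 = 0" "c 1 \<noteq> 0 \<or> c 2 \<noteq> 0"
  shows "card (plane_inf c) \<le> (q\<^sup>2 - 1) * (q\<^sup>2 + 1)"
proof -
  have "plane_inf c \<subseteq> {p. c 1 * fst p + c 2 * snd p = 0} \<times> UNIV - {((0, 0), 0)}"
    by (auto simp: plane_inf_def assms(1) simp del: add_eq_0_iff_char_2)
  hence "card (plane_inf c) \<le> card ({p. c 1 * fst p + c 2 * snd p = 0} \<times> (UNIV :: 'a set) - {((0, 0), 0)})"
    by (intro card_mono) auto
  thus ?thesis by (simp only: card_infinite_line[OF assms(2)])
qed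

text \<open>This bounds the whole part at infinity: \<open>?A\<close> holds the multiples of the
  vertex \<open>(0, 0, 1)\<close>, and \<open>?B\<close> the vectors on the at most three lines
  \<open>x = u * y\<close> away from the vertex.\<close>

lemma card_plane_inf_le: "card (plane_inf c) \<le> (q\<^sup>2 - 1) * (1 + 3 * q\<^sup>2)"
proof -
  let ?M = "{u :: 'a. u ^ (s + 2) = 1}"
  let ?A = "(\<lambda>z. ((0 :: 'a, 0 :: 'a), z)) ` (UNIV - {0 :: 'a})"
  let ?B = "(\<lambda>(u, y, z). ((u * y, y), z)) ` (?M \<times> (UNIV - {0 :: 'a}) \<times> (UNIV :: 'a set))"
  have "plane_inf c \<subseteq> ?A \<union> ?B"
  proof
    fix p assume p: "p \<in> plane_inf c"
    obtain x y z where xyz: "p = ((x, y), z)" by (metis surj_pair)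
    have eq: "x ^ (s + 2) = y ^ (s + 2)" using p by (simp add: plane_inf_def xyz)
    show "p \<in> ?A \<union> ?B"
    proof (cases "y = 0")
      case True
      hence "x = 0" using eq by auto
      moreover from this have "z \<noteq> 0" using p True by (auto simp: plane_inf_def xyz)
      ultimately show ?thesis using True xyz by blast
    next
      case False
      have "(x / y) ^ (s + 2) = 1" using eq False by (simp only: power_divide) simp
      hence "p \<in> ?B" using False xyz by (intro image_eqI[of _ _ "(x / y, y, z)"]) auto
      thus ?thesis by blast
    qed
  qed
  hence "card (plane_inf c) \<le> card (?A \<union> ?B)" by (intro card_mono) auto
  also have "\<dots> \<le> card ?A + card ?B" by (rule card_Un_le)
  also have "\<dots> \<le> card (UNIV - {0 :: 'a}) + card (?M \<times> (UNIV - {0 :: 'a}) \<times> (UNIV :: 'a set))"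
    by (intro add_mono card_image_le) auto
  also have "\<dots> = (q\<^sup>2 - 1) + card ?M * ((q\<^sup>2 - 1) * q\<^sup>2)"
    by (simp add: card_cartesian_product card_Diff_singleton card_UNIV)
  also have "\<dots> \<le> (q\<^sup>2 - 1) + 3 * ((q\<^sup>2 - 1) * q\<^sup>2)"
    by (intro add_left_mono mult_right_mono card_roots_of_unity_le_3) simp
  also have "\<dots> = (q\<^sup>2 - 1) * (1 + 3 * q\<^sup>2)" by (simp add: algebra_simps)
  finally show ?thesis .
qed

lemma card_plane_cone_le:
  assumes "c \<in> coord_space 4" "c \<noteq> 0"
  shows "card (plane_cone c) \<le> (q ^ 3 + q\<^sup>2 + 1) * (q\<^sup>2 - 1)"
proof -
  have q3: "2 * q\<^sup>2 \<le> q ^ 3"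
    using mult_right_mono[OF q_ge_2, of "q\<^sup>2"] by (simp add: power3_eq_cube power2_eq_square)
  have "card (plane_aff c) * (q\<^sup>2 - 1) + card (plane_inf c) \<le> (q ^ 3 + q\<^sup>2 + 1) * (q\<^sup>2 - 1)"
  proof -
    \<comment> \<open>Here \<open>a\<close> bounds the affine points and \<open>b\<close> the points
      at infinity, since each of the latter accounts for \<open>q^2 - 1\<close> vectors.\<close>
    have "\<exists>a b. card (plane_aff c) \<le> a \<and> card (plane_inf c) \<le> b * (q\<^sup>2 - 1) \<and> a + b \<le> q ^ 3 + q\<^sup>2 + 1"
    proof (cases "c 3 = 0")
      case False
      have "q \<le> q\<^sup>2" using q_ge_2 by (simp add: power2_eq_square)
      \<comment> \<open>The up to three points at infinity are paid for by the \<open>- q\<close> of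
        the affine bound, as \<open>q\<close> is at least 2.\<close>
      hence "q ^ 3 + q\<^sup>2 - q + 3 \<le> q ^ 3 + q\<^sup>2 + 1" using q_ge_2 by linarith
      thus ?thesis using card_plane_aff_c3[of c, OF False] card_plane_inf_c3[of c, OF False] by blast
    next
      case c3: True
      show ?thesis
      proof (cases "c 1 \<noteq> 0 \<or> c 2 \<noteq> 0")
        case True
        have "q ^ 3 + (q\<^sup>2 + 1) \<le> q ^ 3 + q\<^sup>2 + 1" by simp
        thus ?thesis using card_plane_aff_vertical[of c, OF c3 True] card_plane_inf_vertical[of c, OF c3 True]
          by (metis order.refl mult.commute)
      next
        case False
        hence c: "c 1 = 0" "c 2 = 0" by auto
        \<comment> \<open>This is the plane at infinity, which has no affine points.\<close>
        have "c 0 \<noteq> 0" using assms vec4_expand[OF assms(1)] vec4_0 c c3 by metis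
        hence "plane_aff c = {}" unfolding plane_aff_def c c3 by simp
        hence "card (plane_aff c) \<le> 0" by simp
        moreover have "0 + (1 + 3 * q\<^sup>2) \<le> q ^ 3 + q\<^sup>2 + 1" using q3 by simp
        ultimately show ?thesis using card_plane_inf_le[of c] by (metis mult.commute)
      qed
    qed
    then obtain a b where ab: "card (plane_aff c) \<le> a" "card (plane_inf c) \<le> b * (q\<^sup>2 - 1)"
      "a + b \<le> q ^ 3 + q\<^sup>2 + 1" by blast
    have "card (plane_aff c) * (q\<^sup>2 - 1) + card (plane_inf c) \<le> a * (q\<^sup>2 - 1) + b * (q\<^sup>2 - 1)"
      by (intro add_mono mult_right_mono ab) simp
    also have "\<dots> = (a + b) * (q\<^sup>2 - 1)" by (simp only: distrib_right)
    also have "\<dots> \<le> (q ^ 3 + q\<^sup>2 + 1) * (q\<^sup>2 - 1)" by (intro mult_right_mono ab) simp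
    finally show ?thesis .
  qed
  thus ?thesis by (simp only: card_plane_cone mult.commute)
qed

text \<open>This plane meets the plane at infinity in a line contained in the variety.\<close>

lemma card_plane_cone_extremal:
  "card (plane_cone (vec4 0 1 1 0)) = (q ^ 3 + q\<^sup>2 + 1) * (q\<^sup>2 - 1)"
proof -
  let ?c = "vec4 0 1 1 (0 :: 'a)"
  have c: "?c 3 = 0" "?c 1 \<noteq> 0 \<or> ?c 2 \<noteq> 0" by simp_all
  have "plane_inf ?c = {p. 1 * fst p + 1 * snd p = 0} \<times> UNIV - {((0, 0), 0)}"
    by (auto simp: plane_inf_def)
  hence "card (plane_inf ?c) = (q\<^sup>2 - 1) * (q\<^sup>2 + 1)"
    using card_infinite_line[of 1 1] by simp
  moreover have "card (plane_aff ?c) = q ^ 3" by (rule card_plane_aff_vertical[of ?c, OF c])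
  ultimately have "card (plane_cone ?c) = (q\<^sup>2 - 1) * (q ^ 3 + (q\<^sup>2 + 1))"
    by (simp only: card_plane_cone distrib_left)
  thus ?thesis by (simp only: mult.commute add.assoc)
qed

text \<open>The zero form imposes no condition, so this counts the whole variety. Having at least
  \<open>q^5\<close> points, it lies in no plane, which makes the encoding injective.\<close>

lemma card_plane_cone_0_ge: "q ^ 5 * (q\<^sup>2 - 1) \<le> card (plane_cone 0)"
proof -
  have "plane_aff 0 = {p. fst p \<in> UNIV \<and> tr (snd p) = \<Gamma> (fst (fst p)) + \<Gamma> (snd (fst p))}"
    by (simp add: plane_aff_def)
  hence "card (plane_aff 0) = card (UNIV :: ('a \<times> 'a) set) * q" by (simp only: card_\<Gamma>_cylinder)
  also have "card (UNIV :: ('a \<times> 'a) set) = q\<^sup>2 * q\<^sup>2"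
    using card_cartesian_product[of "UNIV :: 'a set" "UNIV :: 'a set"] by (simp add: card_UNIV)
  also have "q\<^sup>2 * q\<^sup>2 * q = q ^ 5" by (simp add: eval_nat_numeral)
  finally show ?thesis by (simp only: card_plane_cone mult.commute le_add1)
qed

end

section \<open>The parameters and the weight hierarchy of the code\<close>

theorem corollary3p6:
  fixes e q :: nat and \<epsilon> \<delta> :: "'a::{field,finite}"
    and V :: "(nat \<Rightarrow> 'a) set set" and G :: "nat \<Rightarrow> nat \<Rightarrow> 'a" and C :: "(nat \<Rightarrow> 'a) set"
  assumes "e \<ge> 3" and "odd e" and "q = 2 ^ e"
    and "card (UNIV :: 'a set) = q\<^sup>2"
    and "\<epsilon> \<notin> subfield_of_order q"
    and "\<delta> \<in> subfield_of_order q" and "\<delta> \<noteq> 1"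
    and "(\<Sum>i = 0..e - 1. \<delta> ^ (2 ^ i)) = 1"
    and "\<epsilon>\<^sup>2 + \<epsilon> + \<delta> = 0"
    and "V = V_variety e 3 \<epsilon>"
    and "point_matrix 3 V G"
    and "C = row_code 3 G"
  shows "linear_code (card V) C \<and> fn.dim C = 4
    \<and> int (min_distance C) = int (card V) - int q ^ 3 - int q ^ 2 - 1
    \<and> int (gen_hamming_weight 1 C) = int (card V) - int q ^ 3 - int q ^ 2 - 1
    \<and> int (gen_hamming_weight 2 C) = int (card V) - int q ^ 2 - 1
    \<and> int (gen_hamming_weight 3 C) = int (card V) - 1"
proof -
  interpret suzuki_tits e q "2 ^ ((e + 1) div 2)" \<epsilon> \<delta>
    using assms(2-6,9) by unfold_locales auto
  let ?E = "coord_space 4 :: (nat \<Rightarrow> 'a) set" and ?f = "encode 3 G" and ?N = "card V"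
  let ?Q = "q\<^sup>2 - 1"
  define zeros where "zeros = (\<lambda>D :: (nat \<Rightarrow> 'a) set. card {j. j < ?N \<and> (\<forall>c\<in>D. c j = 0)})"
  have Q: "?Q > 0" using q_ge_2 one_less_power[of q 2] by simp
  have cancel_le: "a \<le> b" if "a * ?Q \<le> b * ?Q" for a b
    using that Q by (simp only: mult_le_cancel2)
  have cancel_eq: "a = b" if "a * ?Q = b * ?Q" for a b
    using that Q by (simp only: mult_cancel2) linarith
  have suc3: "Suc 3 = 4" by simp
  have VPG: "V \<subseteq> PG 3" by (auto simp: assms(10) V_variety_def hypersurface_def)
  have V: "fn.span {v} \<in> V \<longleftrightarrow> v \<in> ?E \<and> cone_eq v" if "v \<noteq> 0" for v
    using span_singleton_in_hypersurface_iff[OF that]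
    by (simp add: assms(10) V_variety_def cone_eq_def suc3)
  have zeros: "zeros (?f ` D) * ?Q = card {v \<in> perp 4 D. v \<noteq> 0 \<and> cone_eq v}" for D
  proof -
    have "{v \<in> perp 4 D. v \<noteq> 0 \<and> fn.span {v} \<in> V} = {v \<in> perp 4 D. v \<noteq> 0 \<and> cone_eq v}"
      using V by (auto simp: perp_def)
    thus ?thesis using card_zero_positions[OF assms(11) VPG, of D]
      by (simp add: zeros_def suc3 card_UNIV)
  qed
  have C: "C = ?f ` ?E" unfolding assms(12) row_code_eq_encode suc3 ..
  have finE: "finite ?E" by (rule card_coord_space)
  have zeros1: "zeros (?f ` D) \<le> q ^ 3 + q\<^sup>2 + 1" if "c \<in> D" "c \<in> ?E" "c \<noteq> 0" for c D
  proof -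
    have "{v \<in> perp 4 D. v \<noteq> 0 \<and> cone_eq v} \<subseteq> plane_cone c"
      using that(1) by (auto simp: perp_def plane_cone_def)
    moreover have "finite (plane_cone c)" by (rule finite_subset[OF _ finE]) (auto simp: plane_cone_def)
    ultimately have "zeros (?f ` D) * ?Q \<le> card (plane_cone c)"
      unfolding zeros by (intro card_mono)
    also have "\<dots> \<le> (q ^ 3 + q\<^sup>2 + 1) * ?Q" by (rule card_plane_cone_le[OF that(2,3)])
    finally show ?thesis by (rule cancel_le)
  qed
  \<comment> \<open>A nonzero form with zero codeword would vanish on the whole variety, giving at
    least \<open>q^5\<close> zeros where a plane allows at most
    \<open>q^3 + q^2 + 1\<close>.\<close>
  have inj: "inj_on ?f ?E"
  proof (rule inj_onI)
    fix c c' assume c: "c \<in> ?E" "c' \<in> ?E" "?f c = ?f c'"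
    let ?d = "c - c'"
    have fd: "?f ?d = 0" using encode_add[of 3 G ?d c'] c(3) by simp
    show "c = c'"
    proof (rule ccontr)
      assume "c \<noteq> c'"
      hence "zeros (?f ` {?d}) \<le> q ^ 3 + q\<^sup>2 + 1"
        using fn.subspace_diff[OF subspace_coord_space c(1,2)] by (intro zeros1[of ?d]) auto
      also have "\<dots> < q ^ 5"
      proof -
        have "2 * q ^ n \<le> q ^ Suc n" for n using q_ge_2 by simp
        from this[of 2] this[of 3] this[of 4]
        have "2 * q ^ 2 \<le> q ^ 3" "2 * q ^ 3 \<le> q ^ 4" "2 * q ^ 4 \<le> q ^ 5" by simp_all
        moreover have "q ^ 2 > 0" using q_ge_2 by simp
        ultimately show ?thesis by linarith
      qed
      finally have lt: "zeros (?f ` {?d}) < q ^ 5" .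
      have "zeros (?f ` {?d}) = zeros (?f ` {0})" by (simp add: fd encode_0)
      moreover have "{v \<in> perp 4 {0}. v \<noteq> 0 \<and> cone_eq v} = plane_cone 0"
        by (auto simp: perp_def plane_cone_def)
      ultimately have "q ^ 5 * ?Q \<le> zeros (?f ` {?d}) * ?Q"
        using zeros[of "{0}"] card_plane_cone_0_ge by (simp only:)
      from cancel_le[OF this] show False using lt by simp
    qed
  qed
  have cardf: "card (?f ` U) = card U" if "U \<subseteq> ?E" for U
    using card_image[OF inj_on_subset[OF inj that]] .
  have subC: "fn.subspace C" unfolding C by (rule subspace_encode_image[OF subspace_coord_space])
  have finC: "finite C" unfolding C using finE by simp
  have CN: "C \<subseteq> coord_space ?N"
    using assms(11) by (auto simp: C coord_space_def encode_def dot_def point_matrix_def)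
  have lin: "linear_code ?N C" using subC CN by (simp add: linear_code_def)
  have dimC: "fn.dim C = 4"
    unfolding dim_eq_iff_card[OF subC finC] unfolding C by (simp only: cardf[OF subset_refl] card_coord_space)
  \<comment> \<open>\<open>pull\<close> and \<open>push\<close> match the
    \<open>m\<close>-dimensional subcodes with the spaces of coefficient vectors having
    \<open>(q^2)^m\<close> elements.\<close>
  have pull: "\<exists>U. fn.subspace U \<and> U \<subseteq> ?E \<and> D = ?f ` U \<and> card U = (q\<^sup>2) ^ m"
    if D: "fn.subspace D" "D \<subseteq> C" "fn.dim D = m" for D m
  proof (intro exI conjI)
    let ?U = "{c \<in> ?E. ?f c \<in> D}"
    show "fn.subspace ?U" by (rule subspace_encode_vimage[OF D(1)])
    show "?U \<subseteq> ?E" by blast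
    show eq: "D = ?f ` ?U" using D(2) by (auto simp: C)
    have "finite D" using D(2) finC finite_subset by blast
    hence "card D = (q\<^sup>2) ^ m" using D by (simp add: card_subspace card_UNIV)
    thus "card ?U = (q\<^sup>2) ^ m" using cardf[of ?U] eq by simp
  qed
  have push: "fn.subspace (?f ` U)" "?f ` U \<subseteq> C" "fn.dim (?f ` U) = m"
    if U: "fn.subspace U" "U \<subseteq> ?E" "card U = (q\<^sup>2) ^ m" for U m
  proof -
    show sub: "fn.subspace (?f ` U)" by (rule subspace_encode_image[OF U(1)])
    show C': "?f ` U \<subseteq> C" using U(2) by (auto simp: C)
    hence "finite (?f ` U)" using finC finite_subset by blast
    thus "fn.dim (?f ` U) = m" using U by (simp add: dim_eq_iff_card[OF sub] cardf card_UNIV)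
  qed
  have card_perp: "card (perp 4 U) * (q\<^sup>2) ^ m = (q\<^sup>2) ^ 4"
    if "fn.subspace U" "U \<subseteq> ?E" "card U = (q\<^sup>2) ^ m" for U m
    using card_times_card_perp[OF that(1,2)] that(3) by (simp add: card_UNIV mult.commute)
  have q0: "q\<^sup>2 > 0" using q_ge_2 by simp
  have perp_card: "card (perp 4 U - {0}) = (q\<^sup>2) ^ (4 - m) - 1" and fin_perp: "finite (perp 4 U)"
    if "fn.subspace U" "U \<subseteq> ?E" "card U = (q\<^sup>2) ^ m" "m \<le> 4" for U m
  proof -
    show "finite (perp 4 U)" by (rule finite_subset[OF _ finE]) (auto simp: perp_def)
    moreover have "0 \<in> perp 4 U" by (auto simp: perp_def coord_space_def dot_def)
    moreover have "(q\<^sup>2) ^ 4 = (q\<^sup>2) ^ (4 - m) * (q\<^sup>2) ^ m" using that(4) by (simp only: power_add[symmetric]) simp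
    hence "card (perp 4 U) = (q\<^sup>2) ^ (4 - m)"
      using card_perp[OF that(1-3)] q0 by (metis mult_right_cancel power_not_zero not_gr_zero)
    ultimately show "card (perp 4 U - {0}) = (q\<^sup>2) ^ (4 - m) - 1" by (simp add: card_Diff_singleton)
  qed
  \<comment> \<open>The bound grants every nonzero vector of the orthogonal space to the cone. It is
    sharp for \<open>m = 2\<close> and \<open>m = 3\<close>; for \<open>m = 1\<close> the plane
    bound \<open>zeros1\<close> replaces it.\<close>
  have zeros_le: "zeros D * ?Q \<le> (q\<^sup>2) ^ (4 - m) - 1"
    if D: "fn.subspace D" "D \<subseteq> C" "fn.dim D = m" "m \<le> 4" for D m
  proof -
    obtain U where U: "fn.subspace U" "U \<subseteq> ?E" "D = ?f ` U" "card U = (q\<^sup>2) ^ m"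
      using pull[OF D(1-3)] by blast
    have "zeros D * ?Q \<le> card (perp 4 U - {0})"
      unfolding U(3) zeros using fin_perp[OF U(1,2,4) D(4)] by (intro card_mono) auto
    thus ?thesis using perp_card[OF U(1,2,4) D(4)] by simp
  qed
  have q4: "(q\<^sup>2) ^ 2 - 1 = (q\<^sup>2 + 1) * ?Q"
    by (simp add: power2_eq_square[of "q\<^sup>2"] algebra_simps)

  \<comment> \<open>The orthogonal spaces are the plane \<open>X_1 = X_2\<close>, its line at
    infinity \<open>X_0 = 0\<close>, \<open>X_1 = X_2\<close>, and the point
    \<open>(0, 0, 0, 1)\<close>; in characteristic 2 the form \<open>X_1 + X_2\<close> cuts out
    \<open>X_1 = X_2\<close>.\<close>
  define U1 where "U1 = range (\<lambda>l :: 'a. vec4 0 l l 0)"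
  define U2 where "U2 = range (\<lambda>(k :: 'a, l). vec4 k l l 0)"
  define U3 where "U3 = range (\<lambda>(k :: 'a, l, m). vec4 k l m 0)"
  have UNIV2: "card (UNIV :: ('a \<times> 'a) set) = (q\<^sup>2) ^ 2"
    and UNIV3: "card (UNIV :: ('a \<times> 'a \<times> 'a) set) = (q\<^sup>2) ^ 3"
    using card_cartesian_product[of "UNIV :: 'a set" "UNIV :: 'a set"]
      card_cartesian_product[of "UNIV :: 'a set" "UNIV :: ('a \<times> 'a) set"]
    by (simp_all add: card_UNIV power2_eq_square power3_eq_cube)
  have U1: "fn.subspace U1" "U1 \<subseteq> ?E" "card U1 = (q\<^sup>2) ^ 1"
  proof -
    show "fn.subspace U1"
      by (rule fn.subspaceI) (auto simp: U1_def vec4_add vec4_scale intro: range_eqI[of _ _ 0] simp flip: vec4_0)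
    show "U1 \<subseteq> ?E" by (auto simp: U1_def vec4_in_coord_space)
    have "inj (\<lambda>l :: 'a. vec4 0 l l 0)" by (auto simp: inj_on_def vec4_eq_iff)
    thus "card U1 = (q\<^sup>2) ^ 1" by (simp add: U1_def card_image card_UNIV)
  qed
  have U2: "fn.subspace U2" "U2 \<subseteq> ?E" "card U2 = (q\<^sup>2) ^ 2"
  proof -
    have mem: "vec4 k l l 0 \<in> U2" for k l by (auto simp: U2_def)
    show "fn.subspace U2"
    proof (rule fn.subspaceI)
      show "0 \<in> U2" using mem[of 0 0] by (simp add: vec4_0)
    qed (auto simp: U2_def vec4_add vec4_scale intro!: mem[unfolded U2_def])
    show "U2 \<subseteq> ?E" by (auto simp: U2_def vec4_in_coord_space)
    have "inj (\<lambda>(k :: 'a, l). vec4 k l l 0)" by (auto simp: inj_on_def vec4_eq_iff)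
    thus "card U2 = (q\<^sup>2) ^ 2" by (simp only: U2_def card_image UNIV2)
  qed
  have U3_mem: "vec4 k l m 0 \<in> U3" for k l m
    unfolding U3_def by (rule range_eqI[of _ _ "(k, l, m)"]) simp
  have U3: "fn.subspace U3" "U3 \<subseteq> ?E" "card U3 = (q\<^sup>2) ^ 3"
  proof -
    show "fn.subspace U3"
    proof (rule fn.subspaceI)
      show "0 \<in> U3" using U3_mem[of 0 0 0] by (simp add: vec4_0)
    qed (auto simp: U3_def vec4_add vec4_scale intro!: U3_mem[unfolded U3_def])
    show "U3 \<subseteq> ?E" by (auto simp: U3_def vec4_in_coord_space)
    have "inj (\<lambda>(k :: 'a, l, m). vec4 k l m 0)" by (auto simp: inj_on_def vec4_eq_iff)
    thus "card U3 = (q\<^sup>2) ^ 3" by (simp only: U3_def card_image UNIV3)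
  qed
  have z1: "zeros (?f ` U1) = q ^ 3 + q\<^sup>2 + 1"
  proof -
    have dot: "dot 4 (vec4 0 l l 0) v = l * dot 4 (vec4 0 1 1 0) v" for l :: 'a and v
      by (simp add: dot_4 distrib_left)
    have "(\<forall>c\<in>U1. dot 4 c v = 0) \<longleftrightarrow> dot 4 (vec4 0 1 1 0) v = 0" for v
    proof
      assume "\<forall>c\<in>U1. dot 4 c v = 0"
      thus "dot 4 (vec4 0 1 1 0) v = 0" by (simp only: U1_def ball_simps)
    next
      assume v: "dot 4 (vec4 0 1 1 0) v = 0"
      show "\<forall>c\<in>U1. dot 4 c v = 0"
      proof
        fix c assume "c \<in> U1"
        then obtain l where "c = vec4 0 l l 0" by (auto simp: U1_def)
        thus "dot 4 c v = 0" using dot[of l v] v by simp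
      qed
    qed
    hence "{v \<in> perp 4 U1. v \<noteq> 0 \<and> cone_eq v} = plane_cone (vec4 0 1 1 0)"
      by (auto simp: perp_def plane_cone_def)
    hence "zeros (?f ` U1) * ?Q = (q ^ 3 + q\<^sup>2 + 1) * ?Q"
      by (simp only: zeros card_plane_cone_extremal)
    thus ?thesis by (rule cancel_eq)
  qed
  \<comment> \<open>Orthogonality to \<open>U2\<close> puts \<open>v\<close> at infinity with
    \<open>v 1 = v 2\<close>, where the equation of the variety holds trivially; hence the bound
    \<open>zeros_le\<close> is attained.\<close>
  have cone: "cone_eq v" if "v \<in> perp 4 U" "U2 \<subseteq> U" for v U
  proof -
    have "vec4 k l l 0 \<in> U" for k l using that(2) by (auto simp: U2_def)
    hence "dot 4 (vec4 k l l 0) v = 0" for k l using that(1) by (auto simp: perp_def)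
    from this[of 1 0] this[of 0 1] have "v 0 = 0" "v 1 = v 2" by (simp_all add: dot_4)
    thus ?thesis using cone_eq_infinity[of v] by simp
  qed
  have z_eq: "zeros (?f ` U) * ?Q = (q\<^sup>2) ^ (4 - m) - 1"
    if U: "fn.subspace U" "U \<subseteq> ?E" "card U = (q\<^sup>2) ^ m" "m \<le> 4" "U2 \<subseteq> U" for U m
  proof -
    have "{v \<in> perp 4 U. v \<noteq> 0 \<and> cone_eq v} = perp 4 U - {0}" using cone U(5) by blast
    thus ?thesis using perp_card[OF U(1-4)] by (simp only: zeros)
  qed
  have "zeros (?f ` U2) * ?Q = (q\<^sup>2 + 1) * ?Q"
    using z_eq[OF U2 _ subset_refl] unfolding q4[symmetric] by simp
  hence z2: "zeros (?f ` U2) = q\<^sup>2 + 1" by (rule cancel_eq)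
  have "U2 \<subseteq> U3" by (auto simp: U2_def U3_mem)
  hence "zeros (?f ` U3) * ?Q = 1 * ?Q" using z_eq[OF U3] by simp
  hence z3: "zeros (?f ` U3) = 1" by (rule cancel_eq)
  have zeros_eq: "card {j. j < ?N \<and> (\<forall>c\<in>D. c j = 0)} = zeros D" for D
    by (simp add: zeros_def)
  note weight = gen_hamming_weight_eqI[OF CN, unfolded zeros_eq]
  have w1: "int (gen_hamming_weight 1 C) = int ?N - int (q ^ 3 + q\<^sup>2 + 1)"
  proof (rule weight[OF push[OF U1] z1])
    fix D assume "fn.subspace D" "D \<subseteq> C" "fn.dim D = 1"
    from pull[OF this] obtain U where U: "fn.subspace U" "U \<subseteq> ?E" "D = ?f ` U" "card U = (q\<^sup>2) ^ 1" by blast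
    have "\<not> U \<subseteq> {0}"
    proof
      assume "U \<subseteq> {0}"
      hence "card U \<le> card {0 :: nat \<Rightarrow> 'a}" by (intro card_mono) auto
      thus False using U(4) Q by simp
    qed
    thus "zeros D \<le> q ^ 3 + q\<^sup>2 + 1" unfolding U(3) using zeros1[of _ U] U(2) by blast
  qed
  have w2: "int (gen_hamming_weight 2 C) = int ?N - int (q\<^sup>2 + 1)"
  proof (rule weight[OF push[OF U2] z2])
    fix D assume "fn.subspace D" "D \<subseteq> C" "fn.dim D = 2"
    from zeros_le[OF this] have "zeros D * ?Q \<le> (q\<^sup>2 + 1) * ?Q" using q4 by simp
    thus "zeros D \<le> q\<^sup>2 + 1" by (rule cancel_le)
  qed
  have w3: "int (gen_hamming_weight 3 C) = int ?N - int 1"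
  proof (rule weight[OF push[OF U3] z3])
    fix D assume "fn.subspace D" "D \<subseteq> C" "fn.dim D = 3"
    from zeros_le[OF this] have "zeros D * ?Q \<le> 1 * ?Q" by simp
    thus "zeros D \<le> 1" by (rule cancel_le)
  qed
  have d: "min_distance C = gen_hamming_weight 1 C"
    by (rule min_distance_eq_gen_hamming_weight_1[OF subC])
  show ?thesis using lin dimC w1 w2 w3 unfolding d by (simp add: algebra_simps)
qed

end
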